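(* Let $n,m\geq 2$, $i\in\{1,\dots,2n\}$, $j\in\{1,\dots,2m\}$ and $k,l\geq 1$. Then the pair $(\alpha_{m,l,j},\beta_{m,l,j})$ is a consequence of the pair $(\alpha_{n,k,i},\beta_{n,k,i})$ if and only if (i) $n\geq m$ and $l>k$, or (ii) $n\geq m$, $l=k$ and $j\geq i+2m-2n$.
   Context: $X$ is a countably infinite set of letters containing distinct letters $x_1,x_2,\dots$. Bi-rooted trees. $\mathfrak B'(X)$ is the set of finite trees (up to isomorphism) with at least two vertices, all vertices labelled by letters of $X$, with an ordered pair of adjacent distinguished vertices (left root, right root). For $\alpha,\beta\in\mathfrak B'(X)$, $\alpha\sqcap\beta$ is the disjoint union of $\alpha$ and $\beta$ with an added edge joining the left root of $\alpha$ to the right root of $\beta$; these two vertices are the left and the right root of $\alpha\sqcap\beta$. A thorn is a degree-one vertex $a$ together with its edge $e$, such that both endpoints of $e$ have the same label; it is essential if $a$ is a root, non-essential otherwise. Reductions: (i) delete a non-essential thorn; (ii) edge-folding: if two distinct vertices with the same label have a common neighbour, merge them (and the two edges to the common neighbour), keeping the label, the merged vertex being a root if one of the merged vertices was. A tree is reduced if no reduction applies; each $\gamma\in\mathfrak B'(X)$ has a unique reduced form $\overline\gamma$. $\mathfrak A(X)$ is the set of reduced trees in $\mathfrak B'(X)$, with operation $\alpha\wedge\beta=\overline{\alpha\sqcap\beta}$; it is the free pseudosemilattice on $X$, with $x\in X$ identified with the single edge both of whose endpoints are labelled $x$. (A pseudosemilattice is a binary algebra satisfying $x\wedge x\approx x$;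 $(x\wedge y)\wedge(x\wedge z)\approx(x\wedge y)\wedge z$; $((x\wedge y)\wedge(x\wedge z))\wedge(x\wedge w)\approx(x\wedge y)\wedge((x\wedge z)\wedge(x\wedge w))$; and the left-right duals of the last two.) A pair $\sigma\in\mathfrak A(X)\times\mathfrak A(X)$ is a consequence of a pair $\tau$ (or of a set $\tau$ of pairs) if it belongs to the fully invariant congruence on $\mathfrak A(X)$ generated by $\tau$ (equivalently, the identity given by $\sigma$ holds in the variety of pseudosemilattices defined by the identities given by $\tau$). The trees. For $n\ge2$, $k\ge1$, $1\le i\le 2n$: $\alpha_{n,k,i}$ is the path $a_1,a_2,\dots,a_{2nk+i}$ (consecutive vertices adjacent), $a_p$ labelled $x_q$ with $1\le q\le 2n$ and $q\equiv p\pmod{2n}$, with left root $a_1$ and right root $a_2$. $\beta_{n,k,i}$ is obtained from $\alpha_{n,k,i}$ by adding one new vertex labelled $x_{2n}$, adjacent only to $a_1$. All these trees are in $\mathfrak A(X)$. *)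

theory Defs
  imports Main "HOL-Library.Countable_Set" "HOL-Library.FuncSet"
begin

text \<open>Vertices are natural numbers; since only finite trees up to isomorphism matter, this is no
  restriction. An undirected edge is represented by both of its orientations. The labelling is a
  total function, but its values outside the vertex set are ignored by isomorphism.\<close>

datatype 'a rgraph =
  RGraph (verts: "nat set") (edges: "(nat \<times> nat) set") (label: "nat \<Rightarrow> 'a") (lroot: nat) (rroot: nat)

definition is_cycle :: "(nat \<times> nat) set \<Rightarrow> nat list \<Rightarrow> bool" where
  "is_cycle E ws \<longleftrightarrow> length ws \<ge> 3 \<and> distinct ws \<and>
     (\<forall>i<length ws. (ws ! i, ws ! (Suc i mod length ws)) \<in> E)"

definition is_tree :: "nat set \<Rightarrow> (nat \<times> nat) set \<Rightarrow> bool" where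
  "is_tree V E \<longleftrightarrow> E \<subseteq> V \<times> V \<and> sym E \<and> irrefl E \<and>
     (\<forall>u\<in>V. \<forall>v\<in>V. (u, v) \<in> E\<^sup>*) \<and> (\<nexists>ws. is_cycle E ws)"

text \<open>Adjacency of the roots forces at least two vertices.\<close>

definition birooted_tree :: "'a rgraph \<Rightarrow> bool" where
  "birooted_tree T \<longleftrightarrow> finite (verts T) \<and> is_tree (verts T) (edges T) \<and> (lroot T, rroot T) \<in> edges T"

definition iso_via :: "(nat \<Rightarrow> nat) \<Rightarrow> 'a rgraph \<Rightarrow> 'a rgraph \<Rightarrow> bool" where
  "iso_via f S T \<longleftrightarrow> bij_betw f (verts S) (verts T) \<and>
     (\<forall>u\<in>verts S. \<forall>v\<in>verts S. (u, v) \<in> edges S \<longleftrightarrow> (f u, f v) \<in> edges T) \<and>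
     (\<forall>v\<in>verts S. label T (f v) = label S v) \<and>
     f (lroot S) = lroot T \<and> f (rroot S) = rroot T"

definition tree_iso :: "'a rgraph \<Rightarrow> 'a rgraph \<Rightarrow> bool" where
  "tree_iso S T \<longleftrightarrow> birooted_tree S \<and> birooted_tree T \<and> (\<exists>f. iso_via f S T)"

lemma birooted_treeD:
  assumes "birooted_tree T"
  shows "edges T \<subseteq> verts T \<times> verts T" "sym (edges T)" "irrefl (edges T)"
    "\<And>u v. u \<in> verts T \<Longrightarrow> v \<in> verts T \<Longrightarrow> (u, v) \<in> (edges T)\<^sup>*"
    "\<And>ws. \<not> is_cycle (edges T) ws" "finite (verts T)" "(lroot T, rroot T) \<in> edges T"
    "lroot T \<in> verts T" "rroot T \<in> verts T"
  using assms unfolding birooted_tree_def is_tree_def by blast+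

lemma tree_iso_refl: "birooted_tree T \<Longrightarrow> tree_iso T T"
  unfolding tree_iso_def iso_via_def by (auto intro!: exI[of _ id])

lemma tree_iso_sym: assumes "tree_iso S T" shows "tree_iso T S"
proof -
  from assms obtain f where S: "birooted_tree S" and T: "birooted_tree T" and f: "iso_via f S T"
    unfolding tree_iso_def by blast
  let ?g = "inv_into (verts S) f"
  have b: "bij_betw f (verts S) (verts T)" using f unfolding iso_via_def by blast
  have g: "?g v \<in> verts S" "f (?g v) = v" if "v \<in> verts T" for v
    using that b by (simp_all add: bij_betw_def inv_into_into f_inv_into_f)
  have gf: "?g (f v) = v" if "v \<in> verts S" for v
    using that b by (simp add: bij_betw_def)
  have "iso_via ?g T S"
    unfolding iso_via_def
  proof (intro conjI ballI)
    show "bij_betw ?g (verts T) (verts S)" by (rule bij_betw_inv_into[OF b])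
    show "(u, v) \<in> edges T \<longleftrightarrow> (?g u, ?g v) \<in> edges S" if "u \<in> verts T" "v \<in> verts T" for u v
      using f g[OF that(1)] g[OF that(2)] unfolding iso_via_def by metis
    show "label S (?g v) = label T v" if "v \<in> verts T" for v
      using f g[OF that] unfolding iso_via_def by metis
    show "?g (lroot T) = lroot S" "?g (rroot T) = rroot S"
      using f gf birooted_treeD(8,9)[OF S] unfolding iso_via_def by metis+
  qed
  then show ?thesis using S T unfolding tree_iso_def by blast
qed

lemma tree_iso_trans: assumes "tree_iso R S" "tree_iso S T" shows "tree_iso R T"
proof -
  from assms obtain f g where R: "birooted_tree R" and T: "birooted_tree T"
    and f: "iso_via f R S" and g: "iso_via g S T"
    unfolding tree_iso_def by blast
  have mem: "f v \<in> verts S" if "v \<in> verts R" for v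
    using f that unfolding iso_via_def by (auto dest: bij_betwE)
  have "bij_betw (g \<circ> f) (verts R) (verts T)"
    using f g bij_betw_trans unfolding iso_via_def by blast
  then have "iso_via (g \<circ> f) R T"
    using f g mem unfolding iso_via_def by (auto simp: o_def)
  then show ?thesis using R T unfolding tree_iso_def by blast
qed

definition edge_tree :: "'a \<Rightarrow> 'a rgraph" where
  "edge_tree x = RGraph {0, 1} {(0, 1), (1, 0)} (\<lambda>_. x) 0 1"

lemma birooted_tree_edge_tree: "birooted_tree (edge_tree x)"
proof -
  have "\<not> is_cycle {(0, 1), (1, 0)} ws" for ws
  proof
    assume c: "is_cycle {(0, 1), (1, 0)} ws"
    then have "set ws \<subseteq> {0, 1}"
      unfolding is_cycle_def by (fastforce simp: in_set_conv_nth)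
    then have "card (set ws) \<le> 2"
      using card_mono[of "{0, 1::nat}" "set ws"] by simp
    then show False using c unfolding is_cycle_def by (simp add: distinct_card)
  qed
  then show ?thesis
    unfolding birooted_tree_def is_tree_def edge_tree_def
    by (auto simp: sym_def irrefl_def)
qed

text \<open>The quotient type is the set of bi-rooted trees up to isomorphism.\<close>

quotient_type 'a birooted = "'a rgraph" / partial: tree_iso
proof (rule part_equivpI)
  show "\<exists>T. tree_iso T T" by (rule exI, rule tree_iso_refl, rule birooted_tree_edge_tree)
  show "symp tree_iso" by (rule sympI) (rule tree_iso_sym)
  show "transp tree_iso" by (rule transpI) (rule tree_iso_trans)
qed

text \<open>The disjoint union is formed by sending the vertices \<open>v\<close> of the first tree to \<open>2 * v\<close>
  and those of the second tree to \<open>2 * v + 1\<close>.\<close>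

definition join_graph :: "'a rgraph \<Rightarrow> 'a rgraph \<Rightarrow> 'a rgraph" where
  "join_graph S T = (let i = (\<lambda>v. 2 * v); j = (\<lambda>v. 2 * v + 1) in
     RGraph (i ` verts S \<union> j ` verts T)
       (map_prod i i ` edges S \<union> map_prod j j ` edges T \<union>
         {(i (lroot S), j (rroot T)), (j (rroot T), i (lroot S))})
       (\<lambda>v. if even v then label S (v div 2) else label T (v div 2))
       (i (lroot S)) (j (rroot T)))"

lemma join_graph_sel:
  "verts (join_graph S T) = (\<lambda>v. 2 * v) ` verts S \<union> (\<lambda>v. 2 * v + 1) ` verts T"
  "edges (join_graph S T) =
     map_prod (\<lambda>v. 2 * v) (\<lambda>v. 2 * v) ` edges S \<union> map_prod (\<lambda>v. 2 * v + 1) (\<lambda>v. 2 * v + 1) ` edges T \<union>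
     {(2 * lroot S, 2 * rroot T + 1), (2 * rroot T + 1, 2 * lroot S)}"
  "label (join_graph S T) = (\<lambda>v. if even v then label S (v div 2) else label T (v div 2))"
  "lroot (join_graph S T) = 2 * lroot S"
  "rroot (join_graph S T) = 2 * rroot T + 1"
  unfolding join_graph_def Let_def rgraph.sel by (rule refl)+

lemma join_graph_edges_iff:
  "(2 * u, 2 * v) \<in> edges (join_graph S T) \<longleftrightarrow> (u, v) \<in> edges S"
  "(2 * u + 1, 2 * v + 1) \<in> edges (join_graph S T) \<longleftrightarrow> (u, v) \<in> edges T"
  "(2 * u, 2 * v + 1) \<in> edges (join_graph S T) \<longleftrightarrow> u = lroot S \<and> v = rroot T"
  "(2 * u + 1, 2 * v) \<in> edges (join_graph S T) \<longleftrightarrow> v = lroot S \<and> u = rroot T"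
proof -
  have "2 * a \<noteq> 2 * b + 1" "2 * b + 1 \<noteq> 2 * a" for a b :: nat by presburger+
  then show "(2 * u, 2 * v) \<in> edges (join_graph S T) \<longleftrightarrow> (u, v) \<in> edges S"
    "(2 * u + 1, 2 * v + 1) \<in> edges (join_graph S T) \<longleftrightarrow> (u, v) \<in> edges T"
    "(2 * u, 2 * v + 1) \<in> edges (join_graph S T) \<longleftrightarrow> u = lroot S \<and> v = rroot T"
    "(2 * u + 1, 2 * v) \<in> edges (join_graph S T) \<longleftrightarrow> v = lroot S \<and> u = rroot T"
    by (fastforce simp: join_graph_sel)+
qed

lemma is_cycle_halve:
  assumes c: "is_cycle E ws"
    and ws: "\<And>w. w \<in> set ws \<Longrightarrow> w = g (w div 2)"
    and E: "\<And>u v. (g u, g v) \<in> E \<Longrightarrow> (u, v) \<in> F"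
  shows "is_cycle F (map (\<lambda>w. w div 2) ws)"
proof -
  have 1: "(ws ! i div 2, ws ! (Suc i mod length ws) div 2) \<in> F" if i: "i < length ws" for i
  proof -
    have "Suc i mod length ws < length ws" using i by (cases ws) auto
    then have eq: "ws ! i = g (ws ! i div 2)"
      "ws ! (Suc i mod length ws) = g (ws ! (Suc i mod length ws) div 2)"
      using i by (blast intro: ws nth_mem)+
    have "(ws ! i, ws ! (Suc i mod length ws)) \<in> E"
      using c i unfolding is_cycle_def by blast
    then show ?thesis by (intro E) (simp only: eq[symmetric])
  qed
  have "inj_on (\<lambda>w. w div 2) (set ws)" by (rule inj_on_inverseI[of _ g]) (rule ws[symmetric])
  moreover have "Suc i mod length ws < length ws" if "i < length ws" for i
    using that by (cases ws) auto
  ultimately show ?thesis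
    using c 1 unfolding is_cycle_def by (auto simp: distinct_map)
qed

lemma cyclic_propagate:
  assumes step: "\<And>i. i < n \<Longrightarrow> P i \<Longrightarrow> P (Suc i mod n)" and i: "i < n" "P i" and j: "j < n"
  shows "P (j::nat)"
proof -
  have "P ((i + k) mod n)" for k
  proof (induction k)
    case (Suc k)
    have "(i + k) mod n < n" using i by simp
    from step[OF this Suc.IH] show ?case by (simp add: mod_Suc_eq)
  qed (use i in simp)
  moreover have "(i + (n - i + j)) mod n = j" using i j by simp
  ultimately show ?thesis by metis
qed

lemma join_graph_acyclic:
  assumes S: "birooted_tree S" and T: "birooted_tree T"
  shows "\<not> is_cycle (edges (join_graph S T)) ws"
proof
  let ?E = "edges (join_graph S T)" and ?n = "length ws"
  assume c: "is_cycle ?E ws"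
  have n: "?n \<ge> 3" and dist: "distinct ws"
    and e: "\<And>i. i < ?n \<Longrightarrow> (ws ! i, ws ! (Suc i mod ?n)) \<in> ?E"
    using c unfolding is_cycle_def by auto
  have lt: "Suc i mod ?n < ?n" for i by (rule mod_less_divisor) (use n in linarith)
  consider (ev) "\<forall>w\<in>set ws. even w" | (od) "\<forall>w\<in>set ws. odd w"
    | (mix) "\<exists>w\<in>set ws. even w" "\<exists>w\<in>set ws. odd w" by blast
  then show False
  proof cases
    case ev
    have "is_cycle (edges S) (map (\<lambda>w. w div 2) ws)"
    proof (rule is_cycle_halve[OF c, of "\<lambda>v. 2 * v"])
      show "w = 2 * (w div 2)" if "w \<in> set ws" for w using ev that by simp
    qed (simp only: join_graph_edges_iff(1))
    then show False using birooted_treeD(5)[OF S] by blast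
  next
    case od
    have "is_cycle (edges T) (map (\<lambda>w. w div 2) ws)"
    proof (rule is_cycle_halve[OF c, of "\<lambda>v. 2 * v + 1"])
      show "w = 2 * (w div 2) + 1" if "w \<in> set ws" for w using od that by simp
    qed (simp only: join_graph_edges_iff(2))
    then show False using birooted_treeD(5)[OF T] by blast
  next
    case mix
    then obtain a b where a: "a < ?n" "even (ws ! a)" and b: "b < ?n" "odd (ws ! b)"
      by (metis in_set_conv_nth)
    have "\<exists>i<?n. even (ws ! i) \<and> odd (ws ! (Suc i mod ?n))"
    proof (rule ccontr)
      assume "\<not> ?thesis"
      then have "even (ws ! b)"
        by (intro cyclic_propagate[of ?n "\<lambda>i. even (ws ! i)", OF _ a b(1)]) auto
      then show False using b(2) by blast
    qed
    then obtain i where i: "i < ?n" "even (ws ! i)" "odd (ws ! (Suc i mod ?n))" by blast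
    have "\<exists>j<?n. odd (ws ! j) \<and> even (ws ! (Suc j mod ?n))"
    proof (rule ccontr)
      assume "\<not> ?thesis"
      then have "odd (ws ! a)"
        by (intro cyclic_propagate[of ?n "\<lambda>i. odd (ws ! i)", OF _ b a(1)]) auto
      then show False using a(2) by blast
    qed
    then obtain j where j: "j < ?n" "odd (ws ! j)" "even (ws ! (Suc j mod ?n))" by blast
    have *: "u = 2 * lroot S \<and> v = 2 * rroot T + 1" 
      if uv: "(u, v) \<in> ?E \<or> (v, u) \<in> ?E" "even u" "odd v" for u v
    proof -
      obtain u' v' where "u = 2 * u'" "v = 2 * v' + 1" using uv(2,3) by (blast elim: evenE oddE)
      with uv(1) show ?thesis by (simp only: join_graph_edges_iff) blast
    qed
    have "ws ! i = ws ! (Suc j mod ?n)" "ws ! j = ws ! (Suc i mod ?n)"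
      using *[OF disjI1, OF e[OF i(1)] i(2,3)] *[OF disjI2, OF e[OF j(1)] j(3,2)] by simp_all
    then have ij: "i = Suc j mod ?n" "j = Suc i mod ?n"
      by (simp_all only: nth_eq_iff_index_eq[OF dist] i(1) j(1) lt)
    have r: "Suc r mod ?n = (if Suc r = ?n then 0 else Suc r)" if "r < ?n" for r
      using that by simp
    have "i = (if Suc j = ?n then 0 else Suc j)" "j = (if Suc i = ?n then 0 else Suc i)"
      using ij r[OF i(1)] r[OF j(1)] by metis+
    with n show False by presburger
  qed
qed

lemma birooted_tree_join:
  assumes S: "birooted_tree S" and T: "birooted_tree T"
  shows "birooted_tree (join_graph S T)"
proof -
  let ?E = "edges (join_graph S T)"
  note s = birooted_treeD[OF S] and t = birooted_treeD[OF T]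
  have sub: "?E \<subseteq> verts (join_graph S T) \<times> verts (join_graph S T)"
    using s(1,8) t(1,9) by (fastforce simp: join_graph_sel)
  have sym: "sym ?E"
    using s(2) t(2) by (fastforce simp: join_graph_sel sym_def)
  have irr: "irrefl ?E"
  proof (rule irreflI)
    show "(v, v) \<notin> ?E" for v
    proof (cases "even v")
      case True
      then show ?thesis using join_graph_edges_iff(1) s(3) by (metis evenE irreflD)
    next
      case False
      then show ?thesis using join_graph_edges_iff(2) t(3) by (metis oddE irreflD)
    qed
  qed
  have cs: "(2 * u, 2 * v) \<in> ?E\<^sup>*" if "(u, v) \<in> (edges S)\<^sup>*" for u v
    using that by induction (auto intro: rtrancl_into_rtrancl simp: join_graph_edges_iff(1))
  have ct: "(2 * u + 1, 2 * v + 1) \<in> ?E\<^sup>*" if "(u, v) \<in> (edges T)\<^sup>*" for u v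
    using that
  proof induction
    case (step y z)
    then show ?case using join_graph_edges_iff(2) rtrancl_into_rtrancl by metis
  qed simp
  have root: "(v, 2 * lroot S) \<in> ?E\<^sup>*" if "v \<in> verts (join_graph S T)" for v
  proof -
    consider u where "u \<in> verts S" "v = 2 * u" | u where "u \<in> verts T" "v = 2 * u + 1"
      using \<open>v \<in> verts (join_graph S T)\<close> by (auto simp: join_graph_sel)
    then show ?thesis
    proof cases
      case 1
      then show ?thesis using cs s(4,8) by blast
    next
      case 2
      have "(2 * rroot T + 1, 2 * lroot S) \<in> ?E" by (simp add: join_graph_sel)
      moreover have "(v, 2 * rroot T + 1) \<in> ?E\<^sup>*" using ct t(4,9) 2 by blast
      ultimately show ?thesis by (meson rtrancl_into_rtrancl)
    qed
  qed
  have "(u, v) \<in> ?E\<^sup>*" if "u \<in> verts (join_graph S T)" "v \<in> verts (join_graph S T)" for u v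
    using root[OF that(1)] root[OF that(2)] sym_rtrancl[OF sym] by (meson rtrancl_trans symD)
  moreover have "finite (verts (join_graph S T))" using s(6) t(6) by (simp add: join_graph_sel)
  moreover have "(lroot (join_graph S T), rroot (join_graph S T)) \<in> ?E" by (simp add: join_graph_sel)
  ultimately show ?thesis
    using sub sym irr join_graph_acyclic[OF S T] unfolding birooted_tree_def is_tree_def by blast
qed

lemma tree_iso_join:
  assumes "tree_iso S S'" "tree_iso T T'"
  shows "tree_iso (join_graph S T) (join_graph S' T')"
proof -
  from assms obtain f g where tr: "birooted_tree S" "birooted_tree S'" "birooted_tree T" "birooted_tree T'"
    and f: "iso_via f S S'" and g: "iso_via g T T'"
    unfolding tree_iso_def by blast
  let ?J = "join_graph S T" and ?J' = "join_graph S' T'"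
  define h where "h v = (if even v then 2 * f (v div 2) else 2 * g (v div 2) + 1)" for v
  have h: "h (2 * v) = 2 * f v" "h (2 * v + 1) = 2 * g v + 1" for v
    by (simp_all add: h_def)
  have bf: "bij_betw f (verts S) (verts S')" and bg: "bij_betw g (verts T) (verts T')"
    using f g unfolding iso_via_def by blast+
  have fS: "inj_on f (verts S)" "f ` verts S = verts S'"
    and gT: "inj_on g (verts T)" "g ` verts T = verts T'"
    using bf bg unfolding bij_betw_def by blast+
  have fr: "f u = lroot S' \<longleftrightarrow> u = lroot S" if "u \<in> verts S" for u
    using f fS(1) that birooted_treeD(8)[OF tr(1)] unfolding iso_via_def by (metis inj_onD)
  have gr: "g u = rroot T' \<longleftrightarrow> u = rroot T" if "u \<in> verts T" for u
    using g gT(1) that birooted_treeD(9)[OF tr(3)] unfolding iso_via_def by (metis inj_onD)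
  have cases_v: "(\<exists>u\<in>verts S. v = 2 * u) \<or> (\<exists>u\<in>verts T. v = 2 * u + 1)" if "v \<in> verts ?J" for v
    using that by (auto simp: join_graph_sel)
  have "iso_via h ?J ?J'"
    unfolding iso_via_def
  proof (intro conjI ballI)
    have "h ` verts ?J = verts ?J'"
      unfolding join_graph_sel image_Un image_image h fS(2)[symmetric] gT(2)[symmetric] ..
    moreover have "inj_on h (verts ?J)"
    proof (rule inj_onI)
      fix u v assume u: "u \<in> verts ?J" and v: "v \<in> verts ?J" and eq: "h u = h v"
      have "Suc (2 * a) \<noteq> 2 * b" "2 * b \<noteq> Suc (2 * a)" for a b :: nat by presburger+
      with cases_v[OF u] cases_v[OF v] eq show "u = v"
        by (auto simp: h_def dest: inj_onD[OF fS(1)] inj_onD[OF gT(1)])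
    qed
    ultimately show "bij_betw h (verts ?J) (verts ?J')" unfolding bij_betw_def by blast
    show "(u, v) \<in> edges ?J \<longleftrightarrow> (h u, h v) \<in> edges ?J'" if "u \<in> verts ?J" "v \<in> verts ?J" for u v
    proof -
      have fE: "\<forall>u\<in>verts S. \<forall>v\<in>verts S. (u, v) \<in> edges S \<longleftrightarrow> (f u, f v) \<in> edges S'"
        and gE: "\<forall>u\<in>verts T. \<forall>v\<in>verts T. (u, v) \<in> edges T \<longleftrightarrow> (g u, g v) \<in> edges T'"
        using f g unfolding iso_via_def by blast+
      from cases_v[OF that(1)] cases_v[OF that(2)] show ?thesis
        by (elim disjE bexE) (simp_all only: h join_graph_edges_iff fE gE fr gr)
    qed
    show "label ?J' (h v) = label ?J v" if "v \<in> verts ?J" for v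
      using cases_v[OF that] f g unfolding iso_via_def
      by (auto simp: join_graph_sel h_def)
    show "h (lroot ?J) = lroot ?J'" "h (rroot ?J) = rroot ?J'"
      using f g unfolding iso_via_def by (auto simp: join_graph_sel h_def)
  qed
  then show ?thesis using tr birooted_tree_join unfolding tree_iso_def by blast
qed

lift_definition bt_join :: "'a birooted \<Rightarrow> 'a birooted \<Rightarrow> 'a birooted" (infixl "\<sqinter>\<^sub>t" 70)
  is join_graph by (rule tree_iso_join)

definition nonessential_thorn :: "'a rgraph \<Rightarrow> nat \<Rightarrow> bool" where
  "nonessential_thorn T a \<longleftrightarrow> a \<noteq> lroot T \<and> a \<noteq> rroot T \<and>
     (\<exists>b. {v. (a, v) \<in> edges T} = {b} \<and> label T a = label T b)"

definition delete_vertex :: "nat \<Rightarrow> 'a rgraph \<Rightarrow> 'a rgraph" where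
  "delete_vertex a T =
     RGraph (verts T - {a}) (edges T \<inter> (verts T - {a}) \<times> (verts T - {a})) (label T) (lroot T) (rroot T)"

definition foldable :: "'a rgraph \<Rightarrow> nat \<Rightarrow> nat \<Rightarrow> bool" where
  "foldable T a b \<longleftrightarrow> a \<in> verts T \<and> b \<in> verts T \<and> a \<noteq> b \<and> label T a = label T b \<and>
     (\<exists>c. (a, c) \<in> edges T \<and> (b, c) \<in> edges T)"

text \<open>The vertex \<open>b\<close> is identified with \<open>a\<close>; the two edges to the common neighbour
  become equal because edges form a set.\<close>

definition merge_vertices :: "nat \<Rightarrow> nat \<Rightarrow> 'a rgraph \<Rightarrow> 'a rgraph" where
  "merge_vertices a b T = (let f = id(b := a) in
     RGraph (f ` verts T) (map_prod f f ` edges T) (label T) (f (lroot T)) (f (rroot T)))"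

inductive reduction :: "'a rgraph \<Rightarrow> 'a rgraph \<Rightarrow> bool" where
  delete_thorn: "nonessential_thorn T a \<Longrightarrow> reduction T (delete_vertex a T)"
| fold_edges: "foldable T a b \<Longrightarrow> reduction T (merge_vertices a b T)"

definition bt_reduces :: "'a birooted \<Rightarrow> 'a birooted \<Rightarrow> bool" where
  "bt_reduces \<gamma> \<delta> \<longleftrightarrow> (\<exists>S T. birooted_tree S \<and> birooted_tree T \<and>
     \<gamma> = abs_birooted S \<and> \<delta> = abs_birooted T \<and> reduction S T)"

definition bt_reduced :: "'a birooted \<Rightarrow> bool" where
  "bt_reduced \<gamma> \<longleftrightarrow> (\<nexists>\<delta>. bt_reduces \<gamma> \<delta>)"

text \<open>The description is proper because the reductions are terminating and confluent
  up to isomorphism.\<close>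

definition reduced_form :: "'a birooted \<Rightarrow> 'a birooted" where
  "reduced_form \<gamma> = (THE \<delta>. bt_reduces\<^sup>*\<^sup>* \<gamma> \<delta> \<and> bt_reduced \<delta>)"

text \<open>With the operation below, this set is the free pseudosemilattice on the type of letters,
  a letter \<open>x\<close> being identified with the class of \<open>edge_tree x\<close>.\<close>

definition free_psl :: "'a birooted set" where
  "free_psl = {\<gamma>. bt_reduced \<gamma>}"

definition psl_meet :: "'a birooted \<Rightarrow> 'a birooted \<Rightarrow> 'a birooted" (infixl "\<and>\<^sub>t" 70) where
  "\<alpha> \<and>\<^sub>t \<beta> = reduced_form (\<alpha> \<sqinter>\<^sub>t \<beta>)"

definition psl_endo :: "('a birooted \<Rightarrow> 'a birooted) \<Rightarrow> bool" where
  "psl_endo \<phi> \<longleftrightarrow> \<phi> \<in> free_psl \<rightarrow> free_psl \<and>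
     (\<forall>\<alpha>\<in>free_psl. \<forall>\<beta>\<in>free_psl. \<phi> (\<alpha> \<and>\<^sub>t \<beta>) = \<phi> \<alpha> \<and>\<^sub>t \<phi> \<beta>)"

definition psl_congruence :: "('a birooted \<times> 'a birooted) set \<Rightarrow> bool" where
  "psl_congruence \<theta> \<longleftrightarrow> equiv free_psl \<theta> \<and>
     (\<forall>\<alpha> \<alpha>' \<beta> \<beta>'. (\<alpha>, \<alpha>') \<in> \<theta> \<longrightarrow> (\<beta>, \<beta>') \<in> \<theta> \<longrightarrow> (\<alpha> \<and>\<^sub>t \<beta>, \<alpha>' \<and>\<^sub>t \<beta>') \<in> \<theta>)"

definition fully_invariant :: "('a birooted \<times> 'a birooted) set \<Rightarrow> bool" where
  "fully_invariant \<theta> \<longleftrightarrow> (\<forall>\<phi>. psl_endo \<phi> \<longrightarrow> (\<forall>(\<alpha>, \<beta>)\<in>\<theta>. (\<phi> \<alpha>, \<phi> \<beta>) \<in> \<theta>))"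

definition fi_congruence_generated ::
    "('a birooted \<times> 'a birooted) set \<Rightarrow> ('a birooted \<times> 'a birooted) set" where
  "fi_congruence_generated \<tau> = \<Inter>{\<theta>. psl_congruence \<theta> \<and> fully_invariant \<theta> \<and> \<tau> \<subseteq> \<theta>}"

definition is_consequence :: "'a birooted \<times> 'a birooted \<Rightarrow> 'a birooted \<times> 'a birooted \<Rightarrow> bool" where
  "is_consequence \<sigma> \<tau> \<longleftrightarrow> \<sigma> \<in> fi_congruence_generated {\<tau>}"

text \<open>The vertex \<open>a\<^sub>p\<close> is the number \<open>p\<close>, and the letter \<open>x\<^sub>q\<close> is \<open>x q\<close>; the
  index \<open>(p - 1) mod (2 * n) + 1\<close> is the representative of \<open>p\<close> modulo \<open>2 * n\<close> in \<open>{1..2 * n}\<close>.\<close>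

definition alpha_graph :: "(nat \<Rightarrow> 'a) \<Rightarrow> nat \<Rightarrow> nat \<Rightarrow> nat \<Rightarrow> 'a rgraph" where
  "alpha_graph x n k i =
     RGraph {1..2 * n * k + i}
       {(p, q). p \<in> {1..2 * n * k + i} \<and> q \<in> {1..2 * n * k + i} \<and> (q = p + 1 \<or> p = q + 1)}
       (\<lambda>p. x ((p - 1) mod (2 * n) + 1)) 1 2"

text \<open>The additional vertex is the number 0.\<close>

definition beta_graph :: "(nat \<Rightarrow> 'a) \<Rightarrow> nat \<Rightarrow> nat \<Rightarrow> nat \<Rightarrow> 'a rgraph" where
  "beta_graph x n k i = (let T = alpha_graph x n k i in
     RGraph (insert 0 (verts T)) (edges T \<union> {(0, 1), (1, 0)}) ((label T)(0 := x (2 * n)))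
       (lroot T) (rroot T))"

lemma is_tree_interval:
  "is_tree {s..t} {(p, q). p \<in> {s..t} \<and> q \<in> {s..t} \<and> (q = p + 1 \<or> p = q + 1)}"
proof -
  let ?E = "{(p, q). p \<in> {s..t} \<and> q \<in> {s..t} \<and> (q = p + 1 \<or> p = q + 1)}"
  have sym: "sym ?E" by (auto simp: sym_def)
  have "(s, v) \<in> ?E\<^sup>*" if "s \<le> v" "v \<le> t" for v
    using that
  proof (induction v rule: dec_induct)
    case (step v)
    then have "(v, Suc v) \<in> ?E" by auto
    with step show ?case by (meson Suc_leD rtrancl_into_rtrancl)
  qed simp
  then have "(u, v) \<in> ?E\<^sup>*" if "u \<in> {s..t}" "v \<in> {s..t}" for u v
    using that sym_rtrancl[OF sym] by (meson atLeastAtMost_iff rtrancl_trans symD)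
  moreover have "\<not> is_cycle ?E ws" for ws
  proof
    let ?n = "length ws"
    assume c: "is_cycle ?E ws"
    have n: "?n \<ge> 3" and dist: "distinct ws"
      and e: "\<And>i. i < ?n \<Longrightarrow> (ws ! i, ws ! (Suc i mod ?n)) \<in> ?E"
      using c unfolding is_cycle_def by auto
    have "Max (set ws) \<in> set ws" using n by (intro Max_in) auto
    then obtain i where i: "i < ?n" "ws ! i = Max (set ws)" by (metis in_set_conv_nth)
    have max: "ws ! j \<le> ws ! i" if "j < ?n" for j using i(2) that by simp
    define j where "j = (if i = 0 then ?n - 1 else i - 1)"
    have j: "j < ?n" "Suc j mod ?n = i" using n i(1) by (auto simp: j_def)
    have "Suc i mod ?n < ?n" by (rule mod_less_divisor) (use n in linarith)
    then have "ws ! i = ws ! (Suc i mod ?n) + 1" "ws ! i = ws ! j + 1"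
      using e[OF i(1)] e[OF j(1)] j max[of j] max[of "Suc i mod ?n"] by auto
    then have "j = Suc i mod ?n"
      using dist j(1) \<open>Suc i mod ?n < ?n\<close> by (simp add: nth_eq_iff_index_eq)
    then show False using n i(1) by (auto simp: j_def mod_Suc split: if_splits)
  qed
  ultimately show ?thesis
    unfolding is_tree_def using sym by (auto simp: irrefl_def)
qed

lemma birooted_tree_alpha_beta:
  assumes "n \<ge> 2" "k \<ge> 1"
  shows "birooted_tree (alpha_graph x n k i)" "birooted_tree (beta_graph x n k i)"
proof -
  have "2 * n * k \<ge> 4 * 1" using assms by (intro mult_le_mono) auto
  then have N: "2 * n * k + i \<ge> 2" by linarith
  then show "birooted_tree (alpha_graph x n k i)"
    using is_tree_interval[of 1 "2 * n * k + i"] unfolding birooted_tree_def alpha_graph_def by auto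
  have "insert 0 {1..2 * n * k + i} = {0..2 * n * k + i}" by auto
  moreover have "{(p, q). p \<in> {1..2 * n * k + i} \<and> q \<in> {1..2 * n * k + i} \<and> (q = p + 1 \<or> p = q + 1)}
      \<union> {(0, 1), (1, 0)}
    = {(p, q). p \<in> {0..2 * n * k + i} \<and> q \<in> {0..2 * n * k + i} \<and> (q = p + 1 \<or> p = q + 1)}"
    using N by auto
  ultimately show "birooted_tree (beta_graph x n k i)"
    using is_tree_interval[of 0 "2 * n * k + i"] N
    unfolding birooted_tree_def beta_graph_def alpha_graph_def Let_def rgraph.sel by auto
qed

definition alpha_tree :: "(nat \<Rightarrow> 'a) \<Rightarrow> nat \<Rightarrow> nat \<Rightarrow> nat \<Rightarrow> 'a birooted" where
  "alpha_tree x n k i = abs_birooted (alpha_graph x n k i)"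

definition beta_tree :: "(nat \<Rightarrow> 'a) \<Rightarrow> nat \<Rightarrow> nat \<Rightarrow> nat \<Rightarrow> 'a birooted" where
  "beta_tree x n k i = abs_birooted (beta_graph x n k i)"

end

theory Submission
  imports Defs
begin

text \<open>For a labelled graph \<open>\<Gamma>\<close> that is folded and has a thorn at every vertex, let \<open>\<gamma>\<close> act on \<open>\<Gamma>\<close> by the
  relation of all pairs of images of its two roots under homomorphisms \<open>\<gamma> \<rightarrow> \<Gamma>\<close>. This relation is
  invariant under both reductions, the relation of \<open>\<alpha> \<and> \<beta>\<close> depends only on those of \<open>\<alpha>\<close> and \<open>\<beta>\<close>, and a
  reduced tree is determined by its relations on all such \<open>\<Gamma>\<close> (take for \<open>\<Gamma>\<close> the tree itself with
  thorns added). So reduced forms are unique, and identities can be checked on relations.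

  If the numerical condition holds, send the letter number \<open>q\<close> to number \<open>1\<close> for \<open>q \<le> 2n - 2m\<close> and to
  number \<open>q - (2n - 2m)\<close> otherwise. The image of \<open>\<alpha>(n,k,i)\<close> folds into \<open>\<alpha>(m,l,j)\<close>, and the meet with
  \<open>\<alpha>(m,l,j)\<close> turns the image of the first pair into the second pair. If the condition fails, take for
  \<open>\<Gamma>\<close> the path \<open>\<alpha>(m,l,j)\<close> with thorns. The pairs that have equal relations on \<open>\<Gamma>\<close> under every
  endomorphism form a fully invariant congruence that does not contain the pair for \<open>(m,l,j)\<close>. It contains
  the pair for \<open>(n,k,i)\<close>: a substitution instance of \<open>\<alpha>(n,k,i)\<close> in \<open>\<Gamma>\<close> gives a walk with labels of
  period \<open>2n\<close>, which must return to its first vertex after one period for lack of space, so that the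
  additional leaf is already present there.\<close>

section \<open>Non-backtracking walks and rooted trees\<close>

text \<open>The head is the moving end, so walks grow at the front. A single vertex counts as a walk
  whether or not it belongs to the graph.\<close>

fun nbwalk :: "(nat \<times> nat) set \<Rightarrow> nat list \<Rightarrow> bool" where
  "nbwalk E [] = False"
| "nbwalk E [v] = True"
| "nbwalk E (v # u # p) \<longleftrightarrow> (v, u) \<in> E \<and> (p \<noteq> [] \<longrightarrow> v \<noteq> hd p) \<and> nbwalk E (u # p)"

lemma nbwalk_nth:
  assumes "nbwalk E p" "Suc i < length p"
  shows "(p ! i, p ! Suc i) \<in> E"
  using assms
proof (induction E p arbitrary: i rule: nbwalk.induct)
  case (3 E v u p)
  then show ?case by (cases i) auto
qed auto

lemma nbwalk_tl: "nbwalk E p \<Longrightarrow> tl p \<noteq> [] \<Longrightarrow> nbwalk E (tl p)"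
  by (cases "(E, p)" rule: nbwalk.cases) auto

text \<open>Cut at the first recurrence of its head, a walk with a repetition would yield a cycle:
  irreflexivity excludes a return after one step, and the non-backtracking condition a return after
  two.\<close>

lemma nbwalk_distinct:
  assumes "irrefl E" "\<And>ws. \<not> is_cycle E ws" "nbwalk E p"
  shows "distinct p"
  using assms(3)
proof (induction p)
  case (Cons v p)
  show ?case
  proof (cases "p = []")
    case False
    with Cons have p: "distinct p" using nbwalk_tl[of E "v # p"] by simp
    have "v \<notin> set p"
    proof
      assume "v \<in> set p"
      then obtain as bs where p_eq: "p = as @ v # bs" "v \<notin> set as"
        by (meson split_list_first)
      have "as \<noteq> []"
        using nbwalk_nth[OF Cons.prems, of 0] p_eq(1) assms(1) by (auto simp: irrefl_def)
      moreover have "as \<noteq> [a]" for a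
        using Cons.prems p_eq(1) by auto
      ultimately have len: "length as \<ge> 2"
        by (cases as; cases "tl as") auto
      have "is_cycle E (v # as)"
        unfolding is_cycle_def
      proof (intro conjI allI impI)
        show "distinct (v # as)" using p p_eq by auto
        fix i assume i: "i < length (v # as)"
        have "(v # as) ! i = (v # p) ! i"
          using i unfolding p_eq(1) by (metis append_Cons nth_append)
        moreover have "(v # as) ! (Suc i mod length (v # as)) = (v # p) ! Suc i"
        proof (cases "i = length as")
          case True
          then show ?thesis by (simp add: p_eq(1))
        next
          case False
          with i show ?thesis by (simp add: p_eq(1) nth_append)
        qed
        ultimately show "((v # as) ! i, (v # as) ! (Suc i mod length (v # as))) \<in> E"
          using nbwalk_nth[OF Cons.prems, of i] i p_eq(1) by simp
      qed (use len in simp)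
      with assms(2) show False by blast
    qed
    with p show ?thesis by simp
  qed simp
qed simp

text \<open>Moving the first vertex of \<open>p\<close> to the front of \<open>q\<close> keeps both walks non-backtracking, so
  eventually \<open>q\<close> becomes a closed non-backtracking walk.\<close>

lemma nbwalk_no_fork:
  assumes E: "sym E" "irrefl E" "\<And>ws. \<not> is_cycle E ws"
    and "nbwalk E p" "nbwalk E q" "hd p = hd q" "last p = last q" "length q \<ge> 2"
    and "length p \<ge> 2 \<longrightarrow> p ! 1 \<noteq> q ! 1"
  shows False
  using assms(4-)
proof (induction p arbitrary: q)
  case (Cons v p)
  obtain b q1 where q: "q = v # b # q1"
    using Cons.prems by (cases q; cases "tl q") auto
  show False
  proof (cases p)
    case Nil
    then have "last (b # q1) = v" using Cons.prems q by simp
    then have "\<not> distinct q" unfolding q using last_in_set[of "b # q1"] by auto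
    then show False using nbwalk_distinct[OF E(2,3) Cons.prems(2)] by simp
  next
    case p: (Cons a p1)
    show False
    proof (rule Cons.IH)
      show "nbwalk E p" using Cons.prems(1) p by simp
      show "nbwalk E (a # q)"
        using Cons.prems p q E(1) by (auto dest: symD)
      show "hd p = hd (a # q)" "last p = last (a # q)" "2 \<le> length (a # q)"
        using Cons.prems p q by auto
      show "2 \<le> length p \<longrightarrow> p ! 1 \<noteq> (a # q) ! 1"
        using Cons.prems(1) p q by (cases p1) auto
    qed
  qed
qed simp

text \<open>Common initial vertices are stripped off. At the first difference
  \<open>nbwalk_no_fork\<close> applies, with the roles of the walks exchanged if the second one
  stops first.\<close>

lemma nbwalk_unique:
  assumes E: "sym E" "irrefl E" "\<And>ws. \<not> is_cycle E ws"
    and "nbwalk E p" "nbwalk E q" "hd p = hd q" "last p = last q"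
  shows "p = q"
  using assms(4-)
proof (induction p arbitrary: q)
  case (Cons v p)
  note no_fork = nbwalk_no_fork[OF E]
  obtain q1 where q: "q = v # q1"
    using Cons.prems by (cases q) auto
  consider "p = []" "q1 = []" | "p = []" "q1 \<noteq> []" | "p \<noteq> []" "q1 = []"
    | "p \<noteq> []" "q1 \<noteq> []" "hd p \<noteq> hd q1" | "p \<noteq> []" "q1 \<noteq> []" "hd p = hd q1" by blast
  then show ?case
  proof cases
    case 2
    have False
      by (rule no_fork[OF Cons.prems]) (use 2 q in \<open>simp_all add: Suc_le_eq\<close>)
    then show ?thesis ..
  next
    case 3
    have False
      by (rule no_fork[OF Cons.prems(2,1) Cons.prems(3,4)[symmetric]])
        (use 3 q in \<open>simp_all add: Suc_le_eq\<close>)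
    then show ?thesis ..
  next
    case 4
    have False
      by (rule no_fork[OF Cons.prems]) (use 4 q in \<open>simp_all add: Suc_le_eq hd_conv_nth\<close>)
    then show ?thesis ..
  next
    case 5
    have "p = q1"
    proof (rule Cons.IH)
      show "nbwalk E p" "nbwalk E q1"
        using nbwalk_tl[OF Cons.prems(1)] nbwalk_tl[OF Cons.prems(2)] 5 q by simp_all
    qed (use Cons.prems 5 q in simp_all)
    then show ?thesis using q by simp
  qed (use q in simp)
qed simp

text \<open>The walk is built along a chain of edges; a step that would backtrack shortens the walk
  instead of extending it.\<close>

lemma nbwalk_exists:
  assumes "(r, v) \<in> E\<^sup>*" "sym E"
  shows "\<exists>p. nbwalk E p \<and> hd p = v \<and> last p = r"
  using assms(1)
proof induction
  case base
  show ?case by (rule exI[of _ "[r]"]) simp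
next
  case (step y z)
  then obtain p where p: "nbwalk E p" "hd p = y" "last p = r" by blast
  then obtain p1 where p1: "p = y # p1" by (cases p) auto
  show ?case
  proof (cases "p1 \<noteq> [] \<and> hd p1 = z")
    case True
    then show ?thesis using p p1 nbwalk_tl[of E p] by auto
  next
    case False
    then have "nbwalk E (z # p)" using p p1 step(2) assms(2) by (auto dest: symD)
    then show ?thesis using p p1 by (intro exI[of _ "z # p"]) auto
  qed
qed

text \<open>Describing a tree by a parent function makes it easy to see that the reductions preserve
  trees: root the tree at the neighbour of the vertices that are merged or deleted.\<close>

definition rooted_tree ::
    "nat set \<Rightarrow> (nat \<times> nat) set \<Rightarrow> nat \<Rightarrow> (nat \<Rightarrow> nat) \<Rightarrow> (nat \<Rightarrow> nat) \<Rightarrow> bool" where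
  "rooted_tree V E r par d \<longleftrightarrow> r \<in> V \<and> (\<forall>v\<in>V - {r}. par v \<in> V \<and> d v = Suc (d (par v))) \<and>
     E = (\<Union>v\<in>V - {r}. {(v, par v), (par v, v)})"

text \<open>The parent of \<open>v\<close> is the second vertex of the unique non-backtracking walk
  from \<open>v\<close> to \<open>r\<close>, and the depth of \<open>v\<close> is the number of
  vertices on that walk.\<close>

lemma is_tree_imp_rooted_tree:
  assumes "is_tree V E" "r \<in> V"
  obtains par d where "rooted_tree V E r par d"
proof -
  have E: "sym E" "irrefl E" "\<And>ws. \<not> is_cycle E ws" and sub: "E \<subseteq> V \<times> V"
    and conn: "\<And>v. v \<in> V \<Longrightarrow> (r, v) \<in> E\<^sup>*"
    using assms unfolding is_tree_def by auto
  obtain w where w: "nbwalk E (w v)" "hd (w v) = v" "last (w v) = r" if "v \<in> V" for v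
    using nbwalk_exists[OF conn E(1)] by metis
  have w_eq: "w v = p" if "nbwalk E p" "hd p = v" "last p = r" "v \<in> V" for p v
    using nbwalk_unique[OF E w(1)] w that by metis
  define par where "par v = w v ! 1" for v
  define d where "d v = length (w v)" for v
  have step: "w v = v # w (par v) \<and> par v \<in> V \<and> (v, par v) \<in> E" if v: "v \<in> V - {r}" for v
  proof -
    obtain u p where p: "w v = v # u # p"
      using w[of v] v by (cases "(E, w v)" rule: nbwalk.cases) auto
    then have "(v, u) \<in> E" using w(1)[of v] v by auto
    moreover then have "u \<in> V" using sub by auto
    moreover have "w u = u # p" using w[of v] v p \<open>u \<in> V\<close> by (intro w_eq) auto
    ultimately show ?thesis using p by (simp add: par_def)
  qed
  \<comment> \<open>The edge either is the first step of the walk from \<open>u\<close>, or can be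
    put in front of that walk to give the walk from \<open>v\<close>.\<close>
  have edge: "(v \<noteq> r \<and> u = par v) \<or> (u \<noteq> r \<and> v = par u)" if uv: "(u, v) \<in> E" for u v
  proof -
    have V: "u \<in> V" "v \<in> V" "u \<noteq> v" using uv sub E(2) by (auto simp: irrefl_def)
    obtain p where p: "w u = u # p" using w[OF V(1)] by (cases "w u") auto
    show ?thesis
    proof (cases "p \<noteq> [] \<and> hd p = v")
      case True
      then have "u \<noteq> r"
        using w_eq[of "[r]" r] p assms(2) by auto
      then show ?thesis using True p by (cases p) (auto simp: par_def)
    next
      case False
      have "nbwalk E (v # u # p)"
        using False uv E(1) w(1)[OF V(1)] p by (auto dest: symD)
      moreover have "last (v # u # p) = r" using w(3)[OF V(1)] p by auto
      ultimately have wv: "w v = v # u # p" using V by (intro w_eq) auto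
      moreover then have "v \<noteq> r"
        using w_eq[of "[r]" r] assms(2) by auto
      ultimately show ?thesis by (simp add: par_def)
    qed
  qed
  have "E = (\<Union>v\<in>V - {r}. {(v, par v), (par v, v)})" (is "E = ?F")
  proof (rule set_eqI, rule iffI)
    fix e assume "e \<in> E"
    then show "e \<in> ?F" using edge[of "fst e" "snd e"] sub by (cases e) fastforce
  next
    fix e assume "e \<in> ?F"
    then show "e \<in> E" using step E(1) by (auto dest: symD)
  qed
  then have "rooted_tree V E r par d"
    unfolding rooted_tree_def d_def using assms(2) step by (metis length_Cons)
  then show thesis by (rule that)
qed

text \<open>Parents have smaller depth, so every vertex is joined to the root. On a cycle, a vertex
  of maximal depth would have its parent as both of its neighbours, against distinctness.\<close>

lemma rooted_tree_imp_is_tree: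
  assumes "rooted_tree V E r par d"
  shows "is_tree V E"
proof -
  have r: "r \<in> V" and par: "\<And>v. v \<in> V - {r} \<Longrightarrow> par v \<in> V"
    and d: "\<And>v. v \<in> V - {r} \<Longrightarrow> d v = Suc (d (par v))"
    and E: "E = (\<Union>v\<in>V - {r}. {(v, par v), (par v, v)})"
    using assms unfolding rooted_tree_def by blast+
  have sub: "E \<subseteq> V \<times> V" unfolding E using par by auto
  have sym: "sym E" unfolding E sym_def by blast
  have irr: "irrefl E" unfolding E irrefl_def using d by fastforce
  have "(v, r) \<in> E\<^sup>*" if "v \<in> V" for v
    using that
  proof (induction "d v" arbitrary: v rule: less_induct)
    case less
    show ?case
    proof (cases "v = r")
      case False
      then have "(par v, r) \<in> E\<^sup>*" using less par d by simp
      moreover have "(v, par v) \<in> E" unfolding E using False less by blast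
      ultimately show ?thesis by (rule converse_rtrancl_into_rtrancl[rotated])
    qed simp
  qed
  then have conn: "(u, v) \<in> E\<^sup>*" if "u \<in> V" "v \<in> V" for u v
    using that sym_rtrancl[OF sym] by (meson rtrancl_trans symD)
  have "\<not> is_cycle E ws" for ws
  proof
    let ?n = "length ws"
    assume c: "is_cycle E ws"
    have n: "?n \<ge> 3" and dist: "distinct ws"
      and e: "\<And>i. i < ?n \<Longrightarrow> (ws ! i, ws ! (Suc i mod ?n)) \<in> E"
      using c unfolding is_cycle_def by auto
    have "Max (d ` set ws) \<in> d ` set ws" using n by (intro Max_in) auto
    then obtain i where i: "i < ?n" "d (ws ! i) = Max (d ` set ws)"
      by (metis imageE in_set_conv_nth)
    have max: "d (ws ! j) \<le> d (ws ! i)" if "j < ?n" for j using i(2) that by simp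
    \<comment> \<open>The cyclic predecessor of \<open>i\<close>.\<close>
    define j where "j = (if i = 0 then ?n - 1 else i - 1)"
    have j: "j < ?n" "Suc j mod ?n = i" using n i(1) by (auto simp: j_def)
    have lt: "Suc i mod ?n < ?n" by (rule mod_less_divisor) (use n in linarith)
    have up: "u = par v" if "(u, v) \<in> E \<or> (v, u) \<in> E" "d u \<le> d v" for u v
      using that d unfolding E by fastforce
    have "ws ! j = par (ws ! i)" "ws ! (Suc i mod ?n) = par (ws ! i)"
      using up e[OF i(1)] e[OF j(1)] j max[OF j(1)] max[OF lt] by blast+
    then have "j = Suc i mod ?n"
      using dist j(1) lt by (metis nth_eq_iff_index_eq)
    then show False using n i(1) by (auto simp: j_def mod_Suc split: if_splits)
  qed
  then show ?thesis
    unfolding is_tree_def using sub sym irr conn by blast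
qed

section \<open>Reductions preserve trees\<close>

lemma rooted_tree_edge_root:
  assumes "rooted_tree V E r par d" "(v, r) \<in> E"
  shows "par v = r"
proof -
  obtain u where "u \<in> V - {r}" "(v, r) = (u, par u) \<or> (v, r) = (par u, u)"
    using assms unfolding rooted_tree_def by auto
  then show ?thesis by auto
qed

text \<open>With the common neighbour \<open>c\<close> as root, \<open>a\<close> and
  \<open>b\<close> are both children of \<open>c\<close> and have equal depth. Hence composing the
  parent function with the identification \<open>f\<close> describes the quotient, with unchanged
  depths.\<close>

lemma birooted_tree_merge:
  assumes T: "birooted_tree T" and ab: "foldable T a b"
  shows "birooted_tree (merge_vertices a b T)"
proof -
  note t = birooted_treeD[OF T]
  obtain c where c: "(a, c) \<in> edges T" "(b, c) \<in> edges T" and V: "a \<in> verts T" "b \<in> verts T" "a \<noteq> b"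
    using ab unfolding foldable_def by blast
  have cV: "c \<in> verts T" and ne: "c \<noteq> a" "c \<noteq> b" using c t(1,3) by (auto simp: irrefl_def)
  obtain par d where rt: "rooted_tree (verts T) (edges T) c par d"
    using is_tree_imp_rooted_tree cV T unfolding birooted_tree_def by metis
  have par: "par a = c" "par b = c" using rooted_tree_edge_root[OF rt] c by auto
  define f where "f = id(b := a)"
  have f: "f b = a" "\<And>v. v \<noteq> b \<Longrightarrow> f v = v" by (simp_all add: f_def)
  have da: "d a = d b"
    using rt par V ne unfolding rooted_tree_def by auto
  have df: "d (f v) = d v" for v using da by (simp add: f_def)
  have fV: "f ` verts T = verts T - {b}"
    using V by (force simp: f_def)
  have "rooted_tree (f ` verts T) (map_prod f f ` edges T) c (\<lambda>v. f (par v)) d"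
    unfolding rooted_tree_def
  proof (intro conjI ballI)
    show "c \<in> f ` verts T" using cV ne fV by simp
    show "f (par v) \<in> f ` verts T" "d v = Suc (d (f (par v)))" if "v \<in> f ` verts T - {c}" for v
      using that rt unfolding fV df rooted_tree_def using fV by auto
    have "map_prod f f ` edges T = (\<Union>v\<in>verts T - {c}. {(f v, f (par v)), (f (par v), f v)})"
      using rt unfolding rooted_tree_def by (auto simp: image_UN)
    also have "\<dots> = (\<Union>v\<in>verts T - {b} - {c}. {(f v, f (par v)), (f (par v), f v)})" (is "?L = ?R")
    proof
      show "?L \<subseteq> ?R"
      proof
        fix e assume "e \<in> ?L"
        then obtain v where v: "v \<in> verts T - {c}" "e \<in> {(f v, f (par v)), (f (par v), f v)}" by blast
        show "e \<in> ?R"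
        proof (cases "v = b")
          case True
          then have "e \<in> {(f a, f (par a)), (f (par a), f a)}" using v par f V by auto
          then show ?thesis using V ne by blast
        qed (use v in blast)
      qed
    qed blast
    also have "\<dots> = (\<Union>v\<in>f ` verts T - {c}. {(v, f (par v)), (f (par v), v)})"
      unfolding fV using f(2) by auto
    finally show "map_prod f f ` edges T = \<dots>" .
  qed
  from rooted_tree_imp_is_tree[OF this] show ?thesis
    using t(6,7) unfolding birooted_tree_def merge_vertices_def Let_def rgraph.sel f_def by force
qed

text \<open>With its only neighbour \<open>b\<close> as root, the thorn \<open>a\<close> is the
  parent of no vertex, so the same parent function describes what remains.\<close>

lemma birooted_tree_delete:
  assumes T: "birooted_tree T" and a: "nonessential_thorn T a"
  shows "birooted_tree (delete_vertex a T)"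
proof -
  note t = birooted_treeD[OF T]
  obtain b where b: "{v. (a, v) \<in> edges T} = {b}" and ne: "a \<noteq> lroot T" "a \<noteq> rroot T"
    using a unfolding nonessential_thorn_def by blast
  then have ab: "(a, b) \<in> edges T" by blast
  then have V: "a \<in> verts T" "b \<in> verts T" "a \<noteq> b" using t(1,3) by (auto simp: irrefl_def)
  obtain par d where rt: "rooted_tree (verts T) (edges T) b par d"
    using is_tree_imp_rooted_tree V T unfolding birooted_tree_def by metis
  let ?V = "verts T - {a}"
  have E: "edges T = (\<Union>v\<in>verts T - {b}. {(v, par v), (par v, v)})"
    and rt': "\<And>v. v \<in> verts T - {b} \<Longrightarrow> par v \<in> verts T \<and> d v = Suc (d (par v))"
    using rt unfolding rooted_tree_def by blast+
  have par: "par v \<noteq> a" if "v \<in> ?V - {b}" for v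
  proof
    assume "par v = a"
    then have "(a, v) \<in> edges T" using that E by blast
    then show False using that b by blast
  qed
  have "edges T \<inter> ?V \<times> ?V = (\<Union>v\<in>?V - {b}. {(v, par v), (par v, v)})" (is "?L = ?R")
  proof
    show "?L \<subseteq> ?R" unfolding E by blast
    show "?R \<subseteq> ?L" using par rt' unfolding E by blast
  qed
  then have "rooted_tree ?V (edges T \<inter> ?V \<times> ?V) b par d"
    unfolding rooted_tree_def using V par rt' by blast
  from rooted_tree_imp_is_tree[OF this] show ?thesis
    using t(6-9) ne unfolding birooted_tree_def delete_vertex_def rgraph.sel by auto
qed

lemma birooted_tree_reduction: "reduction S T \<Longrightarrow> birooted_tree S \<Longrightarrow> birooted_tree T"
  by (auto elim!: reduction.cases intro: birooted_tree_merge birooted_tree_delete)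

section \<open>Homomorphisms into folded graphs\<close>

text \<open>A folded graph is one in which edge-folding has nothing left to do and in which every vertex
  has a thorn; consequently neither reduction changes which homomorphisms into it exist.\<close>

definition folded_graph :: "('b \<times> 'b) set \<Rightarrow> ('b \<Rightarrow> 'a) \<Rightarrow> bool" where
  "folded_graph A L \<longleftrightarrow> sym A \<and> (\<forall>u v w. (u, v) \<in> A \<longrightarrow> (u, w) \<in> A \<longrightarrow> L v = L w \<longrightarrow> v = w) \<and>
     (\<forall>u\<in>Field A. \<exists>v. (u, v) \<in> A \<and> L v = L u)"

lemma folded_graph_sym: "folded_graph A L \<Longrightarrow> (u, v) \<in> A \<Longrightarrow> (v, u) \<in> A"
  unfolding folded_graph_def by (blast dest: symD)

lemma folded_graph_inj:
  "folded_graph A L \<Longrightarrow> (u, v) \<in> A \<Longrightarrow> (u, w) \<in> A \<Longrightarrow> L v = L w \<Longrightarrow> v = w"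
  unfolding folded_graph_def by blast

lemma folded_graph_thorn:
  assumes "folded_graph A L" "(u, v) \<in> A \<or> (v, u) \<in> A"
  obtains w where "(u, w) \<in> A" "(w, u) \<in> A" "L w = L u"
  using assms unfolding folded_graph_def Field_def by (blast dest: symD)

definition hom :: "('b \<times> 'b) set \<Rightarrow> ('b \<Rightarrow> 'a) \<Rightarrow> 'a rgraph \<Rightarrow> (nat \<Rightarrow> 'b) \<Rightarrow> bool" where
  "hom A L T g \<longleftrightarrow> (\<forall>(u, v)\<in>edges T. (g u, g v) \<in> A) \<and> (\<forall>v\<in>verts T. L (g v) = label T v)"

definition rel :: "('b \<times> 'b) set \<Rightarrow> ('b \<Rightarrow> 'a) \<Rightarrow> 'a rgraph \<Rightarrow> ('b \<times> 'b) set" where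
  "rel A L T = {(g (lroot T), g (rroot T)) | g. hom A L T g}"

lemma homI:
  "(\<And>u v. (u, v) \<in> edges T \<Longrightarrow> (g u, g v) \<in> A) \<Longrightarrow> (\<And>v. v \<in> verts T \<Longrightarrow> L (g v) = label T v)
    \<Longrightarrow> hom A L T g"
  unfolding hom_def by blast

lemma hom_edge: "hom A L T g \<Longrightarrow> (u, v) \<in> edges T \<Longrightarrow> (g u, g v) \<in> A"
  unfolding hom_def by blast

lemma hom_label: "hom A L T g \<Longrightarrow> v \<in> verts T \<Longrightarrow> L (g v) = label T v"
  unfolding hom_def by blast

lemma relI: "hom A L T g \<Longrightarrow> u = g (lroot T) \<Longrightarrow> v = g (rroot T) \<Longrightarrow> (u, v) \<in> rel A L T"
  unfolding rel_def by blast

lemma relE: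
  assumes "(u, v) \<in> rel A L T"
  obtains g where "hom A L T g" "u = g (lroot T)" "v = g (rroot T)"
  using assms unfolding rel_def by blast

section \<open>Relations under isomorphism, joins and reductions\<close>

lemma rel_iso_subset:
  assumes "tree_iso S T"
  shows "rel A L T \<subseteq> rel A L S"
proof
  obtain f where S: "birooted_tree S" and f: "iso_via f S T"
    using assms unfolding tree_iso_def by blast
  have fV: "f v \<in> verts T" if "v \<in> verts S" for v
    using f that unfolding iso_via_def bij_betw_def by blast
  fix e assume "e \<in> rel A L T"
  then obtain g where g: "hom A L T g" "e = (g (lroot T), g (rroot T))" unfolding rel_def by blast
  have "hom A L S (g \<circ> f)"
  proof (rule homI)
    show "((g \<circ> f) u, (g \<circ> f) v) \<in> A" if "(u, v) \<in> edges S" for u v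
    proof -
      have "u \<in> verts S" "v \<in> verts S" using that birooted_treeD(1)[OF S] by auto
      then have "(f u, f v) \<in> edges T" using that f unfolding iso_via_def by blast
      then show ?thesis using hom_edge[OF g(1)] by simp
    qed
    show "L ((g \<circ> f) v) = label S v" if "v \<in> verts S" for v
      using f that hom_label[OF g(1) fV[OF that]] unfolding iso_via_def by simp
  qed
  then show "e \<in> rel A L S"
    using f g(2) unfolding iso_via_def by (auto intro!: relI)
qed

lemma rel_iso: "tree_iso S T \<Longrightarrow> rel A L S = rel A L T"
  using rel_iso_subset tree_iso_sym by blast

text \<open>A homomorphism of the join is a pair of homomorphisms whose images of the left root of
  \<open>S\<close> and the right root of \<open>T\<close> are adjacent. The two other roots are
  forgotten, so only a domain and a range enter.\<close>

lemma rel_join: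
  assumes S: "birooted_tree S" and T: "birooted_tree T" and A: "folded_graph A L"
  shows "rel A L (join_graph S T) = {(u, v) \<in> A. u \<in> Domain (rel A L S) \<and> v \<in> Range (rel A L T)}"
    (is "?L = ?R")
proof
  let ?J = "join_graph S T"
  show "?L \<subseteq> ?R"
  proof
    fix e assume "e \<in> ?L"
    then obtain g where g: "hom A L ?J g" "e = (g (lroot ?J), g (rroot ?J))" unfolding rel_def by blast
    have "hom A L S (\<lambda>v. g (2 * v))"
      using hom_edge[OF g(1)] hom_label[OF g(1)] by (auto intro!: homI simp: join_graph_sel)
    then have "(g (2 * lroot S), g (2 * rroot S)) \<in> rel A L S" by (rule relI) auto
    moreover have "hom A L T (\<lambda>v. g (2 * v + 1))"
    proof (rule homI)
      show "(g (2 * u + 1), g (2 * v + 1)) \<in> A" if "(u, v) \<in> edges T" for u v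
        by (rule hom_edge[OF g(1)]) (simp only: join_graph_edges_iff that)
      show "L (g (2 * v + 1)) = label T v" if "v \<in> verts T" for v
        using that hom_label[OF g(1), of "2 * v + 1"] by (simp add: join_graph_sel)
    qed
    then have "(g (2 * lroot T + 1), g (2 * rroot T + 1)) \<in> rel A L T" by (rule relI) auto
    moreover have "(g (2 * lroot S), g (2 * rroot T + 1)) \<in> A"
      by (rule hom_edge[OF g(1)]) (simp add: join_graph_sel)
    ultimately show "e \<in> ?R" using g(2) by (auto simp: join_graph_sel)
  qed
  show "?R \<subseteq> ?L"
  proof
    fix e assume "e \<in> ?R"
    then obtain g h where e: "e = (g (lroot S), h (rroot T))" "e \<in> A" and g: "hom A L S g"
      and h: "hom A L T h"
      by (auto elim!: relE)
    define f where "f v = (if even v then g (v div 2) else h (v div 2))" for v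
    have f: "f (2 * v) = g v" "f (Suc (2 * v)) = h v" for v by (simp_all add: f_def)
    have "hom A L ?J f"
    proof (rule homI)
      show "(f u, f v) \<in> A" if "(u, v) \<in> edges ?J" for u v
        using that hom_edge[OF g] hom_edge[OF h] e folded_graph_sym[OF A]
        by (auto simp: join_graph_sel f)
      show "L (f v) = label ?J v" if "v \<in> verts ?J" for v
        using that hom_label[OF g] hom_label[OF h] by (auto simp: join_graph_sel f)
    qed
    then show "e \<in> ?L" using e by (auto intro!: relI simp: join_graph_sel f)
  qed
qed

lemma rel_edge_tree:
  assumes "folded_graph A L"
  shows "rel A L (edge_tree x) = {(u, v) \<in> A. L u = x \<and> L v = x}" (is "?L = ?R")
proof
  show "?L \<subseteq> ?R"
    by (auto elim!: relE simp: hom_def edge_tree_def)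
  show "?R \<subseteq> ?L"
  proof
    fix e assume e: "e \<in> ?R"
    obtain u v where uv: "e = (u, v)" by (cases e)
    have "(u, v) \<in> A" "(v, u) \<in> A" "L u = x" "L v = x" using e uv folded_graph_sym[OF assms] by auto
    then have "hom A L (edge_tree x) (\<lambda>p. if p = 0 then u else v)"
      by (simp add: hom_def edge_tree_def)
    then show "e \<in> ?L" unfolding uv by (rule relI) (simp_all add: edge_tree_def)
  qed
qed

lemma birooted_tree_incident:
  assumes "birooted_tree T" "v \<in> verts T"
  obtains u where "(v, u) \<in> edges T"
proof (cases "v = lroot T")
  case True
  then show thesis using that birooted_treeD(7)[OF assms(1)] by blast
next
  case False
  then show thesis
    using birooted_treeD(4)[OF assms(1,2) birooted_treeD(8)[OF assms(1)]] that
    by (auto elim: converse_rtranclE)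
qed

text \<open>In a folded graph the equally labelled neighbours \<open>a\<close> and \<open>b\<close>
  of \<open>c\<close> have the same image under every homomorphism, so homomorphisms of
  \<open>T\<close> factor through the merge.\<close>

lemma rel_merge:
  assumes T: "birooted_tree T" and ab: "foldable T a b" and A: "folded_graph A L"
  shows "rel A L (merge_vertices a b T) = rel A L T" (is "?L = ?R")
proof
  define f where "f = id(b := a)"
  have M: "verts (merge_vertices a b T) = f ` verts T" 
    "edges (merge_vertices a b T) = map_prod f f ` edges T"
    "label (merge_vertices a b T) = label T"
    "lroot (merge_vertices a b T) = f (lroot T)" "rroot (merge_vertices a b T) = f (rroot T)"
    unfolding merge_vertices_def f_def Let_def rgraph.sel by (rule refl)+
  obtain c where c: "(a, c) \<in> edges T" "(b, c) \<in> edges T" and V: "a \<in> verts T" "b \<in> verts T"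
    and lab: "label T a = label T b"
    using ab unfolding foldable_def by blast
  have lf: "label T (f v) = label T v" for v using lab by (simp add: f_def)
  show "?L \<subseteq> ?R"
  proof
    fix e assume "e \<in> ?L"
    then obtain g where g: "hom A L (merge_vertices a b T) g" "e = (g (f (lroot T)), g (f (rroot T)))"
      unfolding rel_def M by blast
    then have "hom A L T (g \<circ> f)" unfolding hom_def M by (auto simp: lf)
    then show "e \<in> ?R" using g(2) by (auto intro: relI)
  qed
  show "?R \<subseteq> ?L"
  proof
    fix e assume "e \<in> ?R"
    then obtain g where g: "hom A L T g" "e = (g (lroot T), g (rroot T))"
      unfolding rel_def by blast
    have "g a = g b"
      using folded_graph_inj[OF A] folded_graph_sym[OF A] hom_edge[OF g(1)] hom_label[OF g(1)] c V lab
      by metis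
    then have gf: "g (f v) = g v" for v by (simp add: f_def)
    have "hom A L (merge_vertices a b T) g"
      using hom_edge[OF g(1)] hom_label[OF g(1)] by (intro homI) (auto simp: M gf lf)
    then show "e \<in> ?L" using g(2) by (auto intro!: relI simp: M gf)
  qed
qed

text \<open>A homomorphism of the smaller tree extends to \<open>a\<close> by sending it to the
  thorn at the image of its neighbour.\<close>

lemma rel_delete:
  assumes T: "birooted_tree T" and a: "nonessential_thorn T a" and A: "folded_graph A L"
  shows "rel A L (delete_vertex a T) = rel A L T" (is "?L = ?R")
proof
  let ?D = "delete_vertex a T"
  have D: "verts ?D = verts T - {a}" 
    "edges ?D = edges T \<inter> (verts T - {a}) \<times> (verts T - {a})"
    "label ?D = label T" "lroot ?D = lroot T" "rroot ?D = rroot T"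
    unfolding delete_vertex_def by simp_all
  note t = birooted_treeD[OF T]
  obtain b where b: "{v. (a, v) \<in> edges T} = {b}" "label T a = label T b"
    and ne: "a \<noteq> lroot T" "a \<noteq> rroot T"
    using a unfolding nonessential_thorn_def by blast
  then have ab: "(a, b) \<in> edges T" by blast
  then have V: "a \<in> verts T" "b \<in> verts T" "a \<noteq> b" using t(1,3) by (auto simp: irrefl_def)
  show "?R \<subseteq> ?L"
  proof
    fix e assume "e \<in> ?R"
    then obtain g where g: "hom A L T g" "e = (g (lroot T), g (rroot T))"
      unfolding rel_def by blast
    have "hom A L ?D g"
      using hom_edge[OF g(1)] hom_label[OF g(1)] by (intro homI) (auto simp: D)
    then show "e \<in> ?L" using g(2) by (auto intro!: relI simp: D)
  qed
  show "?L \<subseteq> ?R"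
  proof
    fix e assume "e \<in> ?L"
    then obtain g where g: "hom A L ?D g" "e = (g (lroot T), g (rroot T))"
      unfolding rel_def D by blast
    \<comment> \<open>The vertex \<open>b\<close> keeps a neighbour after the deletion, so
      \<open>g b\<close> lies in the field of \<open>A\<close> and has a thorn there.\<close>
    obtain u where "(b, u) \<in> edges ?D"
      using birooted_tree_incident[OF birooted_tree_delete[OF T a]] V D(1) by blast
    then have "(g b, g u) \<in> A" by (rule hom_edge[OF g(1)])
    then obtain w where w: "(g b, w) \<in> A" "(w, g b) \<in> A" "L w = L (g b)"
      using folded_graph_thorn[OF A] by blast
    have gb: "L (g b) = label T b" using hom_label[OF g(1), of b] V D by simp
    have nb: "v = b" if "(a, v) \<in> edges T \<or> (v, a) \<in> edges T" for v
      using that b(1) t(2) by (auto dest: symD)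
    have "hom A L T (g(a := w))"
    proof (rule homI)
      show "((g(a := w)) u, (g(a := w)) v) \<in> A" if "(u, v) \<in> edges T" for u v
      proof (cases "u = a \<or> v = a")
        case True
        then have "(u = a \<and> v = b) \<or> (u = b \<and> v = a)" using that nb by blast
        then show ?thesis using w V by auto
      next
        case False
        then have "(u, v) \<in> edges ?D" using that t(1) D by auto
        then show ?thesis using hom_edge[OF g(1)] False by simp
      qed
      show "L ((g(a := w)) v) = label T v" if "v \<in> verts T" for v
        using that hom_label[OF g(1), of v] w gb b(2) D by simp
    qed
    then show "e \<in> ?R" using g(2) ne by (auto intro!: relI)
  qed
qed

lemma rel_reduction: "reduction S T \<Longrightarrow> birooted_tree S \<Longrightarrow> folded_graph A L \<Longrightarrow> rel A L T = rel A L S"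
  by (auto elim!: reduction.cases simp: rel_merge rel_delete)

section \<open>Words of reduced trees\<close>

definition irreducible_tree :: "'a rgraph \<Rightarrow> bool" where
  "irreducible_tree T \<longleftrightarrow> birooted_tree T \<and> (\<nexists>a. nonessential_thorn T a) \<and> (\<nexists>a b. foldable T a b)"

definition root_walk :: "'a rgraph \<Rightarrow> nat list \<Rightarrow> bool" where
  "root_walk T p \<longleftrightarrow> nbwalk (edges T) p \<and> last p = lroot T"

lemma root_walk_Nil: "\<not> root_walk T []"
  by (simp add: root_walk_def)

lemma root_walk_verts:
  assumes "birooted_tree T" "root_walk T p"
  shows "set p \<subseteq> verts T"
proof -
  have "nbwalk (edges T) p \<Longrightarrow> last p \<in> verts T \<Longrightarrow> set p \<subseteq> verts T"
  proof (induction p)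
    case (Cons v p)
    show ?case
    proof (cases p)
      case (Cons u q)
      then have "(v, u) \<in> edges T" "set p \<subseteq> verts T" using Cons.IH Cons.prems by auto
      then show ?thesis using birooted_treeD(1)[OF assms(1)] by auto
    qed (use Cons.prems in simp)
  qed simp
  then show ?thesis using assms(2) birooted_treeD(8)[OF assms(1)] unfolding root_walk_def by simp
qed

lemma root_walk_tl: "root_walk T (v # p) \<Longrightarrow> p \<noteq> [] \<Longrightarrow> root_walk T p"
  unfolding root_walk_def using nbwalk_tl[of "edges T" "v # p"] by auto

lemma root_walk_ex1:
  assumes "birooted_tree T" "v \<in> verts T"
  shows "\<exists>!p. root_walk T p \<and> hd p = v"
proof -
  note t = birooted_treeD[OF assms(1)]
  show ?thesis
    using nbwalk_exists[OF t(4)[OF t(8) assms(2)] t(2)] nbwalk_unique[OF t(2,3,5)]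
    unfolding root_walk_def by metis
qed

lemma root_walk_edge:
  assumes "birooted_tree T" "root_walk T (u # p)" "(v, u) \<in> edges T"
  shows "root_walk T (v # u # p) \<or> (\<exists>p1. p = v # p1)"
  using assms unfolding root_walk_def by (cases p) auto

text \<open>A word lists the labels along a walk to the left root, so adjacent vertices have words
  one of which is the tail of the other. With one thorn added wherever it is missing, the words of
  a reduced tree form a folded graph that determines the tree.\<close>

definition words :: "'a rgraph \<Rightarrow> 'a list set" where
  "words T = {map (label T) p | p. root_walk T p}"

text \<open>The condition tests only the neighbour towards the root. If an equally labelled
  neighbour lies away from the root, the new word already belongs to \<open>words T\<close>, so
  nothing is added twice.\<close>

definition thorn_words :: "'a rgraph \<Rightarrow> 'a list set" where
  "thorn_words T = {hd w # w | w. w \<in> words T \<and> (tl w = [] \<or> hd (tl w) \<noteq> hd w)}"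

definition word_graph :: "'a rgraph \<Rightarrow> ('a list \<times> 'a list) set" where
  "word_graph T = {(u, v). u \<in> words T \<union> thorn_words T \<and> v \<in> words T \<union> thorn_words T \<and> (u = tl v \<or> v = tl u)}"

lemma words_nonempty: "w \<in> words T \<Longrightarrow> w \<noteq> []"
  unfolding words_def by (auto simp: root_walk_Nil)

lemma words_tl: "w \<in> words T \<Longrightarrow> tl w \<noteq> [] \<Longrightarrow> tl w \<in> words T"
proof -
  assume "w \<in> words T" "tl w \<noteq> []"
  then obtain p where p: "root_walk T p" "w = map (label T) p" "tl p \<noteq> []"
    unfolding words_def by (auto simp: map_tl[symmetric])
  then have "root_walk T (tl p)" using root_walk_tl[of T "hd p" "tl p"] by (cases p) auto
  then show "tl w \<in> words T" unfolding words_def p(2) by (metis (mono_tags, lifting) CollectI map_tl)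
qed

text \<open>Equal letters two places apart would come from two foldable neighbours of the vertex
  between them.\<close>

lemma words_reduced:
  assumes "irreducible_tree T" "x # y # z # w \<in> words T"
  shows "x \<noteq> z"
proof
  assume "x = z"
  obtain p where p: "root_walk T p" "map (label T) p = x # y # z # w"
    using assms(2) unfolding words_def by auto
  then obtain a c b q where q: "p = a # c # b # q" "label T a = x" "label T b = z"
    by (auto simp: map_eq_Cons_conv)
  have T: "birooted_tree T" and nf: "\<not> foldable T a b" using assms(1) unfolding irreducible_tree_def by blast+
  have "(a, c) \<in> edges T" "(c, b) \<in> edges T" "a \<noteq> b" using p(1) q unfolding root_walk_def by auto
  moreover have "(b, c) \<in> edges T" using calculation birooted_treeD(2)[OF T] by (auto dest: symD)
  ultimately have "foldable T a b"
    using q \<open>x = z\<close> birooted_treeD(1)[OF T] unfolding foldable_def by auto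
  with nf show False ..
qed

text \<open>Two extensions of a word by the same letter are equal, and an extension and the tail
  cannot begin with the same letter by \<open>words_reduced\<close>. The thorn at a word is its tail
  or the word with its first letter repeated.\<close>

lemma folded_word_graph:
  assumes T: "irreducible_tree T"
  shows "folded_graph (word_graph T) hd"
proof -
  let ?C = "words T \<union> thorn_words T"
  have ne: "w \<noteq> []" if "w \<in> ?C" for w using that words_nonempty unfolding thorn_words_def by auto
  \<comment> \<open>For an added thorn \<open>x = y\<close>, and the condition in
    \<open>thorn_words\<close> separates \<open>y\<close> from \<open>z\<close>.\<close>
  have red: "x \<noteq> z" if "x # y # z # w \<in> ?C" for x y z w
    using that words_reduced[OF T] unfolding thorn_words_def by auto
  show ?thesis
    unfolding folded_graph_def
  proof (intro conjI allI impI ballI)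
    show "sym (word_graph T)" unfolding word_graph_def sym_def by auto
  next
    fix u v w assume uv: "(u, v) \<in> word_graph T" "(u, w) \<in> word_graph T" "hd v = hd w"
    then have C: "u \<in> ?C" "v \<in> ?C" "w \<in> ?C" and adj: "u = tl v \<or> v = tl u" "u = tl w \<or> w = tl u"
      unfolding word_graph_def by auto
    note n = ne[OF C(1)] ne[OF C(2)] ne[OF C(3)]
    from adj show "v = w"
    proof (elim disjE)
      assume "u = tl v" "u = tl w"
      then show ?thesis using n uv(3) by (metis list.expand)
    next
      assume h: "u = tl v" "w = tl u"
      then have "v = hd v # hd u # hd w # tl w" using n by simp
      then show ?thesis using red C(2) uv(3) by metis
    next
      assume h: "v = tl u" "u = tl w"
      then have "w = hd w # hd u # hd v # tl v" using n by simp
      then show ?thesis using red C(3) uv(3) by metis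
    qed simp
  next
    fix u assume "u \<in> Field (word_graph T)"
    then have u: "u \<in> ?C" unfolding word_graph_def Field_def by auto
    have "\<exists>v\<in>?C. (u = tl v \<or> v = tl u) \<and> hd v = hd u"
    proof (cases "u \<in> words T")
      case True
      show ?thesis
      proof (cases "tl u = [] \<or> hd (tl u) \<noteq> hd u")
        case t: True
        then have "hd u # u \<in> ?C" using True unfolding thorn_words_def by blast
        then show ?thesis by (intro bexI[of _ "hd u # u"]) auto
      next
        case False
        then show ?thesis using words_tl[OF True] by blast
      qed
    next
      case False
      then show ?thesis using u unfolding thorn_words_def by fastforce
    qed
    then show "\<exists>v. (u, v) \<in> word_graph T \<and> hd v = hd u" using u unfolding word_graph_def by blast
  qed
qed

definition word :: "'a rgraph \<Rightarrow> nat \<Rightarrow> 'a list" where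
  "word T v = map (label T) (THE p. root_walk T p \<and> hd p = v)"

lemma word_hd:
  assumes "birooted_tree T" "root_walk T p"
  shows "word T (hd p) = map (label T) p"
proof -
  have "hd p \<in> verts T" using root_walk_verts[OF assms] assms(2) root_walk_Nil by (cases p) auto
  then have "(THE q. root_walk T q \<and> hd q = hd p) = p"
    using root_walk_ex1[OF assms(1)] assms(2) by (intro the1_equality) auto
  then show ?thesis unfolding word_def by simp
qed

lemma root_walk_of:
  assumes "birooted_tree T" "v \<in> verts T"
  obtains p where "root_walk T (v # p)" "word T v = label T v # map (label T) p"
proof -
  obtain p where p: "root_walk T p" "hd p = v" using root_walk_ex1[OF assms] by blast
  then obtain q where "p = v # q" using root_walk_Nil by (cases p) auto
  then show thesis using that[of q] word_hd[OF assms(1) p(1)] p by simp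
qed

lemma root_walk_lroot: "root_walk T [lroot T]"
  by (simp add: root_walk_def)

lemma root_walk_rroot:
  assumes "birooted_tree T"
  shows "root_walk T [rroot T, lroot T]"
  using birooted_treeD(2,7)[OF assms] by (auto simp: root_walk_def dest: symD)

lemma words_eq_image:
  assumes "birooted_tree T"
  shows "words T = word T ` verts T"
proof -
  have "words T \<subseteq> word T ` verts T"
  proof
    fix w assume "w \<in> words T"
    then obtain p where p: "root_walk T p" "w = map (label T) p" unfolding words_def by blast
    moreover have "hd p \<in> verts T"
      using root_walk_verts[OF assms p(1)] p(1) root_walk_Nil by (cases p) auto
    ultimately show "w \<in> word T ` verts T" using word_hd[OF assms] by (metis imageI)
  qed
  moreover have "word T ` verts T \<subseteq> words T"
  proof (rule image_subsetI)
    fix v assume "v \<in> verts T"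
    then obtain p where "root_walk T (v # p)" "word T v = label T v # map (label T) p"
      by (rule root_walk_of[OF assms])
    then show "word T v \<in> words T"
      unfolding words_def by (metis (mono_tags, lifting) CollectI list.map(2))
  qed
  ultimately show ?thesis by blast
qed

text \<open>Going outwards from the root, the label determines the next vertex, since two candidates
  would be foldable.\<close>

lemma root_walk_labels_inj:
  assumes T: "irreducible_tree T" and "root_walk T p" "root_walk T q" "map (label T) p = map (label T) q"
  shows "p = q"
  using assms(2-)
proof (induction p arbitrary: q)
  case Nil
  then show ?case using root_walk_Nil by blast
next
  case (Cons v p)
  have B: "birooted_tree T" using T unfolding irreducible_tree_def by blast
  obtain v' q1 where q: "q = v' # q1" using Cons.prems(2) root_walk_Nil by (cases q) auto
  show ?case
  proof (cases "p = []")
    case True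
    then show ?thesis using Cons.prems q unfolding root_walk_def by auto
  next
    case False
    then have "q1 \<noteq> []" using Cons.prems(3) q by auto
    have "p = q1"
    proof (rule Cons.IH)
      show "root_walk T p" using Cons.prems(1) False by (rule root_walk_tl)
      show "root_walk T q1" using Cons.prems(2) \<open>q1 \<noteq> []\<close> unfolding q by (rule root_walk_tl)
    qed (use Cons.prems(3) q in simp)
    moreover obtain u p1 where p: "p = u # p1" using False by (cases p) auto
    ultimately have e: "(v, u) \<in> edges T" "(v', u) \<in> edges T"
      using Cons.prems q unfolding root_walk_def by auto
    have "v = v'"
    proof (rule ccontr)
      assume "v \<noteq> v'"
      then have "foldable T v v'"
        using e Cons.prems(3) q birooted_treeD(1)[OF B] unfolding foldable_def by auto
      then show False using T unfolding irreducible_tree_def by blast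
    qed
    then show ?thesis using q \<open>p = q1\<close> by simp
  qed
qed

lemma word_bij:
  assumes T: "irreducible_tree T"
  shows "bij_betw (word T) (verts T) (words T)"
proof -
  have B: "birooted_tree T" using T unfolding irreducible_tree_def by blast
  have "inj_on (word T) (verts T)"
  proof (rule inj_onI)
    fix u v assume uv: "u \<in> verts T" "v \<in> verts T" "word T u = word T v"
    obtain p q where p: "root_walk T (u # p)" "word T u = label T u # map (label T) p"
      and q: "root_walk T (v # q)" "word T v = label T v # map (label T) q"
      using root_walk_of[OF B uv(1)] root_walk_of[OF B uv(2)] by metis
    have "u # p = v # q" by (rule root_walk_labels_inj[OF T p(1) q(1)]) (use p q uv in simp)
    then show "u = v" by simp
  qed
  then show ?thesis unfolding bij_betw_def using words_eq_image[OF B] by simp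
qed

text \<open>One direction is \<open>root_walk_edge\<close>. For the other, equal words mean equal
  walks, so a tail of a word comes from a tail of the walk itself.\<close>

lemma word_edge_iff:
  assumes T: "irreducible_tree T" and uv: "u \<in> verts T" "v \<in> verts T"
  shows "(u, v) \<in> edges T \<longleftrightarrow> word T u = tl (word T v) \<or> word T v = tl (word T u)"
proof
  have B: "birooted_tree T" using T unfolding irreducible_tree_def by blast
  note t = birooted_treeD[OF B]
  assume e: "(u, v) \<in> edges T"
  obtain p where p: "root_walk T (v # p)" using root_walk_of[OF B uv(2)] by blast
  from root_walk_edge[OF B p e]
  show "word T u = tl (word T v) \<or> word T v = tl (word T u)"
  proof
    assume "root_walk T (u # v # p)"
    then show ?thesis using word_hd[OF B p] word_hd[OF B, of "u # v # p"] by simp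
  next
    assume "\<exists>p1. p = u # p1"
    then obtain p1 where p1: "p = u # p1" by blast
    then have "root_walk T (u # p1)" using root_walk_tl[OF p] by simp
    then show ?thesis using word_hd[OF B p] word_hd[OF B, of "u # p1"] p1 by simp
  qed
next
  have B: "birooted_tree T" using T unfolding irreducible_tree_def by blast
  note t = birooted_treeD[OF B]
  have *: "(v, u) \<in> edges T" if uv: "u \<in> verts T" "v \<in> verts T" and w: "word T u = tl (word T v)" for u v
  proof -
    obtain p q where p: "root_walk T (u # p)" "word T u = label T u # map (label T) p"
      and q: "root_walk T (v # q)" "word T v = label T v # map (label T) q"
      using root_walk_of[OF B uv(1)] root_walk_of[OF B uv(2)] by metis
    have "q \<noteq> []" using p q w by auto
    then have "u # p = q"
      using root_walk_labels_inj[OF T p(1) root_walk_tl[OF q(1)]] p q w by simp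
    then show ?thesis using q(1) unfolding root_walk_def by auto
  qed
  assume "word T u = tl (word T v) \<or> word T v = tl (word T u)"
  then show "(u, v) \<in> edges T" using * uv t(2) by (blast dest: symD)
qed

text \<open>The map \<open>word T\<close> is a homomorphism of \<open>T\<close> into its word graph,
  so equality of the relations provides a homomorphism \<open>g\<close> of \<open>S\<close> with the
  same images of the roots. As \<open>S\<close> has no foldable pair, \<open>g\<close> never turns
  back, and it sends each vertex of \<open>S\<close> to the word read along its walk in
  \<open>S\<close>.\<close>

lemma rel_words:
  assumes T: "irreducible_tree T" and S: "irreducible_tree S"
    and r: "rel (word_graph T) hd S = rel (word_graph T) hd T"
  shows "words S \<subseteq> words T \<union> thorn_words T" (is ?words)
    and "label S (lroot S) = label T (lroot T)" (is ?l) and "label S (rroot S) = label T (rroot T)" (is ?r)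
proof -
  have B: "birooted_tree T" and BS: "birooted_tree S" using T S unfolding irreducible_tree_def by blast+
  note t = birooted_treeD[OF B] and s = birooted_treeD[OF BS]
  have hd_word: "hd (word T v) = label T v" if "v \<in> verts T" for v
    using root_walk_of[OF B that] by (metis list.sel(1))
  have C: "word T v \<in> words T" if "v \<in> verts T" for v using that words_eq_image[OF B] by blast
  have "hom (word_graph T) hd T (word T)"
  proof (rule homI)
    show "(word T u, word T v) \<in> word_graph T" if "(u, v) \<in> edges T" for u v
      using that word_edge_iff[OF T] C t(1) unfolding word_graph_def by blast
  qed (rule hd_word)
  then have "(word T (lroot T), word T (rroot T)) \<in> rel (word_graph T) hd S"
    unfolding r by (rule relI) auto
  then obtain g where g: "hom (word_graph T) hd S g" "word T (lroot T) = g (lroot S)"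
    "word T (rroot T) = g (rroot S)" by (rule relE)
  show l: ?l ?r using g hom_label[OF g(1)] hd_word t(8,9) s(8,9) by metis+
  have ne: "w \<noteq> []" if "w \<in> words T \<union> thorn_words T" for w
    using that words_nonempty unfolding thorn_words_def by auto
  have gw: "g (hd p) = map (label S) p" if "root_walk S p" for p
    using that
  proof (induction p)
    case Nil
    then show ?case using root_walk_Nil by blast
  next
    case (Cons v p)
    note V = root_walk_verts[OF BS Cons.prems]
    show ?case
    proof (cases p)
      case Nil
      then have "v = lroot S" using Cons.prems unfolding root_walk_def by simp
      moreover have "word T (lroot T) = [label T (lroot T)]"
        using word_hd[OF B root_walk_lroot] by simp
      ultimately show ?thesis using g(2) l Nil by simp
    next
      case p: (Cons u q)
      have gu: "g u = label S u # map (label S) q"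
        using Cons root_walk_tl[OF Cons.prems] p by simp
      have e: "(v, u) \<in> edges S" using Cons.prems p unfolding root_walk_def by simp
      have lv: "hd (g v) = label S v" using hom_label[OF g(1)] V by simp
      have "(g v, g u) \<in> word_graph T" using hom_edge[OF g(1) e] .
      then have nv: "g v \<noteq> []" and adj: "g u = tl (g v) \<or> g v = tl (g u)"
        using ne unfolding word_graph_def by auto
      \<comment> \<open>If the image shortened here, \<open>v\<close> and the next vertex
        \<open>z\<close> of the walk would be equally labelled neighbours of
        \<open>u\<close>.\<close>
      have "g v \<noteq> tl (g u)"
      proof
        assume gv: "g v = tl (g u)"
        then obtain z q1 where q: "q = z # q1" using nv gu by (cases q) auto
        then have "v \<noteq> z" "(u, z) \<in> edges S" using Cons.prems p unfolding root_walk_def by auto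
        moreover have "(z, u) \<in> edges S" using calculation s(2) by (auto dest: symD)
        moreover have "label S v = label S z" using lv gv gu q by simp
        ultimately have "foldable S v z" using e s(1) unfolding foldable_def by auto
        then show False using S unfolding irreducible_tree_def by blast
      qed
      then have "g v = label S v # g u" using adj lv nv by (metis list.collapse)
      then show ?thesis using gu p by simp
    qed
  qed
  show ?words
  proof
    fix w assume "w \<in> words S"
    then obtain p where p: "root_walk S p" "w = map (label S) p" unfolding words_def by blast
    then have "hd p \<in> verts S" using root_walk_verts[OF BS p(1)] root_walk_Nil by (cases p) auto
    then obtain u where "(hd p, u) \<in> edges S" by (rule birooted_tree_incident[OF BS])
    then have "(g (hd p), g u) \<in> word_graph T" by (rule hom_edge[OF g(1)])
    then show "w \<in> words T \<union> thorn_words T" using gw[OF p(1)] p(2) unfolding word_graph_def by auto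
  qed
qed

text \<open>A word of \<open>S\<close> outside \<open>words T\<close> would be an added thorn, read
  at a vertex \<open>v\<close> whose label equals that of the next vertex \<open>u\<close>. This
  \<open>v\<close> is neither a root nor a non-essential thorn, so it has another neighbour
  \<open>z\<close>, labelled differently. The word of \<open>z\<close> extends a missing word and
  does not repeat its first letter, so it is no vertex of the word graph of
  \<open>T\<close>.\<close>

lemma words_subset:
  assumes T: "irreducible_tree T" and S: "irreducible_tree S"
    and r: "rel (word_graph T) hd S = rel (word_graph T) hd T"
  shows "words S \<subseteq> words T"
proof
  have B: "birooted_tree T" and BS: "birooted_tree S" using T S unfolding irreducible_tree_def by blast+
  note t = birooted_treeD[OF B] and s = birooted_treeD[OF BS]
  note rw = rel_words[OF T S r]
  fix w assume w: "w \<in> words S"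
  show "w \<in> words T"
  proof (rule ccontr)
    assume nw: "w \<notin> words T"
    then have "w \<in> thorn_words T" using rw w by blast
    then obtain w0 where w0: "w = hd w0 # w0" "w0 \<in> words T" unfolding thorn_words_def by blast
    obtain p where p: "root_walk S p" "w = map (label S) p" using w unfolding words_def by blast
    have "w0 \<noteq> []" using w0(2) words_nonempty by blast
    then obtain v u q where q: "p = v # u # q" using p(2) w0(1) by (cases p; cases "tl p") auto
    have luv: "label S v = label S u" using p w0 q by auto
    have e: "(v, u) \<in> edges S" using p(1) q unfolding root_walk_def by auto
    have V: "v \<in> verts S" "u \<in> verts S" using e s(1) by auto
    have "v \<noteq> lroot S"
    proof
      assume "v = lroot S"
      then have "p = [lroot S]"
        using root_walk_ex1[OF BS V(1)] p(1) q root_walk_lroot by (metis list.sel(1))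
      then show False using q by simp
    qed
    moreover have "v \<noteq> rroot S"
    proof
      assume "v = rroot S"
      then have "p = [rroot S, lroot S]"
        using root_walk_ex1[OF BS V(1)] p(1) q root_walk_rroot[OF BS] by (metis list.sel(1))
      then have "w = map (label T) [rroot T, lroot T]" using p(2) rw by simp
      then show False using nw root_walk_rroot[OF B] unfolding words_def by blast
    qed
    moreover have "\<not> nonessential_thorn S v" using S unfolding irreducible_tree_def by blast
    ultimately have "{z. (v, z) \<in> edges S} \<noteq> {u}" using luv unfolding nonessential_thorn_def by blast
    then obtain z where z: "(v, z) \<in> edges S" "z \<noteq> u" using e by blast
    have zv: "(z, v) \<in> edges S" "(u, v) \<in> edges S" using z e s(2) by (auto dest: symD)
    have "\<not> foldable S z u" using S unfolding irreducible_tree_def by blast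
    then have lz: "label S z \<noteq> label S v"
      using z zv V luv s(1) unfolding foldable_def by auto
    have "root_walk S (z # p)" using p(1) q z zv unfolding root_walk_def by auto
    then have "label S z # w \<in> words S" unfolding words_def p(2) by (metis (mono_tags, lifting) CollectI list.map(2))
    then have "label S z # w \<in> words T \<union> thorn_words T" using rw by blast
    moreover have "label S z # w \<notin> words T"
      using words_tl[of "label S z # w" T] nw w words_nonempty by auto
    moreover have "label S z # w \<notin> thorn_words T"
      using lz p(2) q unfolding thorn_words_def by auto
    ultimately show False by blast
  qed
qed

text \<open>Both trees have the same words, and the isomorphism matches vertices with equal words.
  The words of the roots consist of the root labels only, so roots go to roots.\<close>

lemma irreducible_iso:
  assumes T: "irreducible_tree T" and S: "irreducible_tree S"
    and r: "\<And>(A :: ('a list \<times> 'a list) set) L. folded_graph A L \<Longrightarrow> rel A L S = rel A L T"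
  shows "tree_iso S (T :: 'a rgraph)"
proof -
  have B: "birooted_tree T" and BS: "birooted_tree S" using T S unfolding irreducible_tree_def by blast+
  note t = birooted_treeD[OF B] and s = birooted_treeD[OF BS]
  note r1 = r[OF folded_word_graph[OF T]] and r2 = r[OF folded_word_graph[OF S], symmetric]
  note lab = rel_words(2,3)[OF T S r1]
  have W: "words S = words T" using words_subset[OF T S r1] words_subset[OF S T r2] by blast
  define f where "f = inv_into (verts T) (word T) \<circ> word S"
  note bT = word_bij[OF T] and bS = word_bij[OF S, unfolded W]
  have f: "bij_betw f (verts S) (verts T)"
    unfolding f_def by (rule bij_betw_trans[OF bS bij_betw_inv_into[OF bT]])
  have fV: "f v \<in> verts T" "word T (f v) = word S v" if "v \<in> verts S" for v
  proof -
    have "word S v \<in> word T ` verts T" using bS bT that unfolding bij_betw_def by blast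
    then show "f v \<in> verts T" "word T (f v) = word S v"
      unfolding f_def by (auto simp: inv_into_into f_inv_into_f)
  qed
  have f_eq: "f v = u" if "u \<in> verts T" "v \<in> verts S" "word S v = word T u" for u v
    using fV[OF that(2)] that bT unfolding bij_betw_def by (metis inj_onD)
  have hdT: "hd (word T v) = label T v" if "v \<in> verts T" for v
    using root_walk_of[OF B that] by (metis list.sel(1))
  have hdS: "hd (word S v) = label S v" if "v \<in> verts S" for v
    using root_walk_of[OF BS that] by (metis list.sel(1))
  have "iso_via f S T"
    unfolding iso_via_def
  proof (intro conjI ballI f)
    show "(u, v) \<in> edges S \<longleftrightarrow> (f u, f v) \<in> edges T" if "u \<in> verts S" "v \<in> verts S" for u v
      using that fV word_edge_iff[OF S] word_edge_iff[OF T] by simp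
    show "label T (f v) = label S v" if "v \<in> verts S" for v
      using fV[OF that] hdT hdS that by metis
    show "f (lroot S) = lroot T"
      using word_hd[OF B root_walk_lroot] word_hd[OF BS root_walk_lroot] lab s(8) t(8) by (intro f_eq) auto
    show "f (rroot S) = rroot T"
      using word_hd[OF B root_walk_rroot[OF B]] word_hd[OF BS root_walk_rroot[OF BS]] lab s(9) t(9)
      by (intro f_eq) auto
  qed
  then show ?thesis unfolding tree_iso_def using B BS by blast
qed

section \<open>Reduced forms\<close>

lemma abs_birooted_eq_iff:
  assumes "birooted_tree S" "birooted_tree T"
  shows "abs_birooted S = abs_birooted T \<longleftrightarrow> tree_iso S T"
  using Quotient_rel[OF Quotient_birooted] tree_iso_refl assms by metis

lemma birooted_cases:
  obtains T where "birooted_tree T" "\<gamma> = abs_birooted T"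
  using Quotient_abs_rep[OF Quotient_birooted] Quotient_rep_reflp[OF Quotient_birooted]
  unfolding tree_iso_def by metis

lift_definition brel :: "('b \<times> 'b) set \<Rightarrow> ('b \<Rightarrow> 'a) \<Rightarrow> 'a birooted \<Rightarrow> ('b \<times> 'b) set"
  is rel by (rule rel_iso)

lemma brel_abs: "birooted_tree T \<Longrightarrow> brel A L (abs_birooted T) = rel A L T"
  by (rule brel.abs_eq) (rule tree_iso_refl)

lemma bt_join_abs:
  "birooted_tree S \<Longrightarrow> birooted_tree T \<Longrightarrow> abs_birooted S \<sqinter>\<^sub>t abs_birooted T = abs_birooted (join_graph S T)"
  by (rule bt_join.abs_eq; rule tree_iso_refl)

lemma brel_join:
  assumes "folded_graph A L"
  shows "brel A L (\<gamma> \<sqinter>\<^sub>t \<delta>) = {(u, v) \<in> A. u \<in> Domain (brel A L \<gamma>) \<and> v \<in> Range (brel A L \<delta>)}"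
proof -
  obtain S T where "birooted_tree S" "\<gamma> = abs_birooted S" "birooted_tree T" "\<delta> = abs_birooted T"
    using birooted_cases by metis
  then show ?thesis
    by (simp add: bt_join_abs brel_abs birooted_tree_join rel_join[OF _ _ assms])
qed

section \<open>Reducibility of representatives and uniqueness of reduced forms\<close>

lemma nonessential_thorn_iso:
  assumes "tree_iso S T" "nonessential_thorn S a"
  shows "\<exists>b. nonessential_thorn T b"
proof -
  obtain f where S: "birooted_tree S" and T: "birooted_tree T" and f: "iso_via f S T"
    using assms(1) unfolding tree_iso_def by blast
  note s = birooted_treeD[OF S] and t = birooted_treeD[OF T]
  have inj: "inj_on f (verts S)" and im: "f ` verts S = verts T"
    using f unfolding iso_via_def bij_betw_def by blast+
  obtain b where b: "{v. (a, v) \<in> edges S} = {b}" "label S a = label S b"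
    and ne: "a \<noteq> lroot S" "a \<noteq> rroot S"
    using assms(2) unfolding nonessential_thorn_def by blast
  have ab: "(a, b) \<in> edges S" using b by blast
  then have V: "a \<in> verts S" "b \<in> verts S" using s(1) by auto
  have "{w. (f a, w) \<in> edges T} = {f b}"
  proof (intro equalityI subsetI)
    fix w assume "w \<in> {w. (f a, w) \<in> edges T}"
    then have w: "(f a, w) \<in> edges T" by simp
    then obtain v where v: "v \<in> verts S" "w = f v" using t(1) im by blast
    then have "(a, v) \<in> edges S" using w f V unfolding iso_via_def by blast
    then have "v \<in> {b}" unfolding b(1)[symmetric] by simp
    then show "w \<in> {f b}" using v by simp
  next
    fix w assume "w \<in> {f b}"
    then show "w \<in> {w. (f a, w) \<in> edges T}" using ab V f unfolding iso_via_def by blast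
  qed
  moreover have "label T (f a) = label T (f b)" using f V b(2) unfolding iso_via_def by simp
  moreover have "f a \<noteq> lroot T" "f a \<noteq> rroot T"
    using f ne inj V s(8,9) unfolding iso_via_def by (metis inj_onD)+
  ultimately show ?thesis unfolding nonessential_thorn_def by blast
qed

lemma foldable_iso:
  assumes "tree_iso S T" "foldable S a b"
  shows "\<exists>a b. foldable T a b"
proof -
  obtain f where S: "birooted_tree S" and f: "iso_via f S T"
    using assms(1) unfolding tree_iso_def by blast
  have inj: "inj_on f (verts S)" and im: "f ` verts S = verts T"
    using f unfolding iso_via_def bij_betw_def by blast+
  obtain c where ab: "a \<in> verts S" "b \<in> verts S" "a \<noteq> b" "label S a = label S b"
    and c: "(a, c) \<in> edges S" "(b, c) \<in> edges S"
    using assms(2) unfolding foldable_def by blast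
  have "c \<in> verts S" using c birooted_treeD(1)[OF S] by auto
  then have "(f a, f c) \<in> edges T" "(f b, f c) \<in> edges T" "label T (f a) = label T (f b)"
    using ab c f unfolding iso_via_def by auto
  moreover have "f a \<in> verts T" "f b \<in> verts T" "f a \<noteq> f b" using ab im inj by (auto dest: inj_onD)
  ultimately show ?thesis unfolding foldable_def by blast
qed

lemma bt_reducesI:
  "birooted_tree S \<Longrightarrow> reduction S T \<Longrightarrow> bt_reduces (abs_birooted S) (abs_birooted T)"
  unfolding bt_reduces_def using birooted_tree_reduction by blast

lemma bt_reduced_abs_iff:
  assumes "birooted_tree T"
  shows "bt_reduced (abs_birooted T) \<longleftrightarrow> irreducible_tree T"
proof
  assume "bt_reduced (abs_birooted T)"
  then have "\<not> reduction T U" for U using bt_reducesI[OF assms] unfolding bt_reduced_def by blast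
  then show "irreducible_tree T"
    unfolding irreducible_tree_def using assms reduction.intros by blast
next
  assume irr: "irreducible_tree T"
  show "bt_reduced (abs_birooted T)"
    unfolding bt_reduced_def
  proof
    assume "\<exists>\<delta>. bt_reduces (abs_birooted T) \<delta>"
    then obtain S U where S: "birooted_tree S" "abs_birooted T = abs_birooted S" "reduction S U"
      unfolding bt_reduces_def by blast
    then have "tree_iso S T" using abs_birooted_eq_iff assms by metis
    with S(3) irr show False
      unfolding irreducible_tree_def
      by (auto elim!: reduction.cases dest: nonessential_thorn_iso foldable_iso)
  qed
qed

lemma brel_bt_reduces:
  assumes "bt_reduces\<^sup>*\<^sup>* \<gamma> \<delta>" "folded_graph A L"
  shows "brel A L \<delta> = brel A L \<gamma>"
  using assms(1)
proof induction
  case (step \<delta> \<epsilon>)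
  from step.hyps(2) obtain S T where ST: "birooted_tree S" "birooted_tree T"
    "\<delta> = abs_birooted S" "\<epsilon> = abs_birooted T" "reduction S T"
    unfolding bt_reduces_def by blast
  have "brel A L \<epsilon> = brel A L \<delta>"
    using rel_reduction[OF ST(5,1) assms(2)] by (simp add: ST(3,4) brel_abs[OF ST(1)] brel_abs[OF ST(2)])
  with step.IH show ?case by simp
qed simp

text \<open>Graphs with lists as vertices suffice, because the separating graphs are the word graphs
  of the two trees.\<close>

lemma psl_eqI:
  assumes "\<gamma> \<in> free_psl" "\<delta> \<in> free_psl"
    and "\<And>(A :: ('a list \<times> 'a list) set) L. folded_graph A L \<Longrightarrow> brel A L \<gamma> = brel A L \<delta>"
  shows "\<gamma> = (\<delta> :: 'a birooted)"
proof -
  obtain S T where S: "birooted_tree S" "\<gamma> = abs_birooted S" and T: "birooted_tree T" "\<delta> = abs_birooted T"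
    using birooted_cases by metis
  have "irreducible_tree S" "irreducible_tree T"
    using assms(1,2) S T bt_reduced_abs_iff unfolding free_psl_def by blast+
  moreover have "rel A L S = rel A L T" if "folded_graph A L" for A :: "('a list \<times> 'a list) set" and L
    using assms(3)[OF that] S T by (simp add: brel_abs)
  ultimately have "tree_iso S T" by (intro irreducible_iso)
  then show ?thesis using S T abs_birooted_eq_iff by blast
qed

lemma reduction_card:
  assumes "birooted_tree S" "reduction S T"
  shows "card (verts T) < card (verts S)"
  using assms(2)
proof cases
  case (delete_thorn a)
  then have "a \<in> verts S"
    using birooted_treeD(1)[OF assms(1)] unfolding nonessential_thorn_def by blast
  moreover have "verts T = verts S - {a}" unfolding delete_thorn delete_vertex_def by simp
  ultimately show ?thesis
    using birooted_treeD(6)[OF assms(1)] by (metis card_Diff1_less)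
next
  case (fold_edges a b)
  then have "a \<in> verts S" "b \<in> verts S" "a \<noteq> b" unfolding foldable_def by blast+
  then have "verts T = verts S - {b}"
    unfolding fold_edges merge_vertices_def Let_def rgraph.sel by force
  then show ?thesis
    using birooted_treeD(6)[OF assms(1)] \<open>b \<in> verts S\<close> by (metis card_Diff1_less)
qed

lemma reduced_form_exists: "\<exists>\<delta>. bt_reduces\<^sup>*\<^sup>* \<gamma> \<delta> \<and> bt_reduced \<delta>"
proof -
  have "\<exists>\<delta>. bt_reduces\<^sup>*\<^sup>* (abs_birooted T) \<delta> \<and> bt_reduced \<delta>" if "birooted_tree T" for T :: "'a rgraph"
    using that
  proof (induction "card (verts T)" arbitrary: T rule: less_induct)
    case less
    show ?case
    proof (cases "\<exists>U. reduction T U")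
      case True
      then obtain U where U: "reduction T U" by blast
      obtain \<delta> where "bt_reduces\<^sup>*\<^sup>* (abs_birooted U) \<delta>" "bt_reduced \<delta>"
        using less.hyps[OF reduction_card[OF less.prems U] birooted_tree_reduction[OF U less.prems]]
        by blast
      then show ?thesis
        using bt_reducesI[OF less.prems U] by (meson converse_rtranclp_into_rtranclp)
    next
      case False
      then have "bt_reduced (abs_birooted T)"
        unfolding bt_reduced_abs_iff[OF less.prems] irreducible_tree_def
        using less.prems reduction.intros by blast
      then show ?thesis by blast
    qed
  qed
  then show ?thesis using birooted_cases by metis
qed

text \<open>Existence holds because every reduction removes a vertex. Any two reduced forms have the
  same relations as \<open>\<gamma>\<close> on all folded graphs, so \<open>psl_eqI\<close>
  identifies them.\<close>

lemma reduced_form: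
  fixes \<gamma> :: "'a birooted"
  shows bt_reduces_reduced_form: "bt_reduces\<^sup>*\<^sup>* \<gamma> (reduced_form \<gamma>)"
    and reduced_form_in_psl: "reduced_form \<gamma> \<in> free_psl"
proof -
  have "\<exists>!\<delta>. bt_reduces\<^sup>*\<^sup>* \<gamma> \<delta> \<and> bt_reduced \<delta>"
  proof (rule ex_ex1I[OF reduced_form_exists])
    fix \<delta> \<epsilon>
    assume \<delta>: "bt_reduces\<^sup>*\<^sup>* \<gamma> \<delta> \<and> bt_reduced \<delta>" and \<epsilon>: "bt_reduces\<^sup>*\<^sup>* \<gamma> \<epsilon> \<and> bt_reduced \<epsilon>"
    show "\<delta> = \<epsilon>"
    proof (rule psl_eqI)
      fix A :: "('a list \<times> 'a list) set" and L :: "'a list \<Rightarrow> 'a"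
      assume A: "folded_graph A L"
      show "brel A L \<delta> = brel A L \<epsilon>"
        using brel_bt_reduces[OF conjunct1[OF \<delta>] A] brel_bt_reduces[OF conjunct1[OF \<epsilon>] A] by simp
    qed (use \<delta> \<epsilon> in \<open>simp_all add: free_psl_def\<close>)
  qed
  from theI'[OF this] show "bt_reduces\<^sup>*\<^sup>* \<gamma> (reduced_form \<gamma>)" "reduced_form \<gamma> \<in> free_psl"
    unfolding reduced_form_def free_psl_def by blast+
qed

lemma psl_meet_in_psl: "\<gamma> \<and>\<^sub>t \<delta> \<in> free_psl"
  unfolding psl_meet_def by (rule reduced_form_in_psl)

lemma brel_reduced_form: "folded_graph A L \<Longrightarrow> brel A L (reduced_form \<gamma>) = brel A L \<gamma>"
  by (rule brel_bt_reduces[OF bt_reduces_reduced_form])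

lemma brel_meet:
  "folded_graph A L \<Longrightarrow>
    brel A L (\<gamma> \<and>\<^sub>t \<delta>) = {(u, v) \<in> A. u \<in> Domain (brel A L \<gamma>) \<and> v \<in> Range (brel A L \<delta>)}"
  unfolding psl_meet_def by (simp add: brel_reduced_form brel_join)

section \<open>Letters and substitution endomorphisms\<close>

definition letter :: "'a \<Rightarrow> 'a birooted" where
  "letter x = abs_birooted (edge_tree x)"

lemma letter_in_psl: "letter x \<in> free_psl"
proof -
  have "irreducible_tree (edge_tree x)"
    unfolding irreducible_tree_def
  proof (intro conjI birooted_tree_edge_tree notI; elim exE)
    fix a assume a: "nonessential_thorn (edge_tree x) a"
    then obtain b where "(a, b) \<in> edges (edge_tree x)" unfolding nonessential_thorn_def by blast
    then have "a = 0 \<or> a = 1" unfolding edge_tree_def by auto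
    with a show False unfolding nonessential_thorn_def edge_tree_def by simp
  next
    fix a b assume "foldable (edge_tree x) a b"
    then obtain c where "(a, c) \<in> edges (edge_tree x)" "(b, c) \<in> edges (edge_tree x)" "a \<noteq> b"
      unfolding foldable_def by blast
    then show False unfolding edge_tree_def by auto
  qed
  then show ?thesis
    by (simp add: letter_def free_psl_def bt_reduced_abs_iff[OF birooted_tree_edge_tree])
qed

text \<open>The thorn at a vertex labelled \<open>x\<close> is the second endpoint of an image of
  the edge.\<close>

lemma brel_letter:
  assumes A: "folded_graph A L"
  shows "Domain (brel A L (letter x)) = {u \<in> Field A. L u = x}"
    and "Range (brel A L (letter x)) = {u \<in> Field A. L u = x}"
proof -
  have eq: "brel A L (letter x) = {(u, v) \<in> A. L u = x \<and> L v = x}"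
    unfolding letter_def brel_abs[OF birooted_tree_edge_tree] by (rule rel_edge_tree[OF A])
  have "\<exists>w. (u, w) \<in> A \<and> (w, u) \<in> A \<and> L w = L u" if "u \<in> Field A" for u
    using that folded_graph_thorn[OF A] unfolding Field_def by blast
  then show "Domain (brel A L (letter x)) = {u \<in> Field A. L u = x}"
    "Range (brel A L (letter x)) = {u \<in> Field A. L u = x}"
    unfolding eq by (auto intro: FieldI1 FieldI2)
qed

definition relabel :: "('a \<Rightarrow> 'a) \<Rightarrow> 'a rgraph \<Rightarrow> 'a rgraph" where
  "relabel f T = RGraph (verts T) (edges T) (f \<circ> label T) (lroot T) (rroot T)"

lemma relabel_sel [simp]:
  "verts (relabel f T) = verts T" "edges (relabel f T) = edges T" "label (relabel f T) = f \<circ> label T"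
  "lroot (relabel f T) = lroot T" "rroot (relabel f T) = rroot T"
  by (simp_all add: relabel_def)

lemma birooted_tree_relabel [simp]: "birooted_tree (relabel f T) \<longleftrightarrow> birooted_tree T"
  unfolding birooted_tree_def by simp

lift_definition bt_relabel :: "('a \<Rightarrow> 'a) \<Rightarrow> 'a birooted \<Rightarrow> 'a birooted" is relabel
  unfolding tree_iso_def iso_via_def by auto

lemma bt_relabel_abs: "birooted_tree T \<Longrightarrow> bt_relabel f (abs_birooted T) = abs_birooted (relabel f T)"
  by (rule bt_relabel.abs_eq) (rule tree_iso_refl)

text \<open>Reductions only ask for equal labels, and relabelling preserves equalities. It may
  create new ones, so a relabelled reduced tree can be reducible.\<close>

lemma reduction_relabel:
  assumes "reduction S T"
  shows "reduction (relabel f S) (relabel f T)"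
  using assms
proof cases
  case (delete_thorn a)
  then have "nonessential_thorn (relabel f S) a" unfolding nonessential_thorn_def by auto
  moreover have "relabel f T = delete_vertex a (relabel f S)"
    unfolding delete_thorn by (simp add: delete_vertex_def relabel_def)
  ultimately show ?thesis by (simp add: reduction.delete_thorn)
next
  case (fold_edges a b)
  then have "foldable (relabel f S) a b" unfolding foldable_def by auto
  moreover have "relabel f T = merge_vertices a b (relabel f S)"
    unfolding fold_edges merge_vertices_def Let_def relabel_def rgraph.sel ..
  ultimately show ?thesis by (simp add: reduction.fold_edges)
qed

lemma bt_reduces_relabel:
  assumes "bt_reduces\<^sup>*\<^sup>* \<gamma> \<delta>"
  shows "bt_reduces\<^sup>*\<^sup>* (bt_relabel f \<gamma>) (bt_relabel f \<delta>)"
  using assms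
proof induction
  case (step \<delta> \<epsilon>)
  from step.hyps(2) obtain S T where ST: "birooted_tree S" "birooted_tree T"
    "\<delta> = abs_birooted S" "\<epsilon> = abs_birooted T" "reduction S T"
    unfolding bt_reduces_def by blast
  have "bt_reduces (bt_relabel f \<delta>) (bt_relabel f \<epsilon>)"
    unfolding ST(3,4) bt_relabel_abs[OF ST(1)] bt_relabel_abs[OF ST(2)]
    using ST(1) reduction_relabel[OF ST(5)] by (intro bt_reducesI) simp_all
  with step.IH show ?case by (rule rtranclp.rtrancl_into_rtrancl)
qed simp

lemma brel_relabel_reduced_form:
  "folded_graph A L \<Longrightarrow> brel A L (bt_relabel f (reduced_form \<gamma>)) = brel A L (bt_relabel f \<gamma>)"
  by (rule brel_bt_reduces[OF bt_reduces_relabel[OF bt_reduces_reduced_form]])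

lemma bt_relabel_join: "bt_relabel f (\<gamma> \<sqinter>\<^sub>t \<delta>) = bt_relabel f \<gamma> \<sqinter>\<^sub>t bt_relabel f \<delta>"
proof -
  obtain S T where ST: "birooted_tree S" "\<gamma> = abs_birooted S" "birooted_tree T" "\<delta> = abs_birooted T"
    using birooted_cases by metis
  have "relabel f (join_graph S T) = join_graph (relabel f S) (relabel f T)"
    unfolding relabel_def join_graph_def Let_def rgraph.sel by (simp add: fun_eq_iff)
  then show ?thesis using ST by (simp add: bt_join_abs bt_relabel_abs birooted_tree_join)
qed

text \<open>Relabelling commutes with joins and carries reductions to reductions, so reducing before
  relabelling does not change the relations of the result.\<close>

lemma psl_endo_relabel: "psl_endo (\<lambda>\<gamma>. reduced_form (bt_relabel f \<gamma>))"
  unfolding psl_endo_def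
proof (intro conjI ballI)
  show "(\<lambda>\<gamma>. reduced_form (bt_relabel f \<gamma>)) \<in> free_psl \<rightarrow> free_psl"
    by (simp add: reduced_form_in_psl)
  show "reduced_form (bt_relabel f (\<alpha> \<and>\<^sub>t \<beta>)) = reduced_form (bt_relabel f \<alpha>) \<and>\<^sub>t reduced_form (bt_relabel f \<beta>)"
    for \<alpha> \<beta>
    by (rule psl_eqI[OF reduced_form_in_psl psl_meet_in_psl])
      (simp add: brel_reduced_form brel_meet brel_join brel_relabel_reduced_form bt_relabel_join
        psl_meet_def[of \<alpha> \<beta>])
qed

section \<open>Paths as terms\<close>

text \<open>The summand \<open>2 * n\<close> keeps the truncated subtraction exact at
  \<open>p = 0\<close>, where the value is \<open>x (2 * n)\<close>, the label of the extra leaf of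
  \<beta>.\<close>

definition periodic_label :: "(nat \<Rightarrow> 'a) \<Rightarrow> nat \<Rightarrow> nat \<Rightarrow> 'a" where
  "periodic_label x n p = x ((p + 2 * n - 1) mod (2 * n) + 1)"

lemma periodic_label_add:
  assumes "1 \<le> q" "q \<le> 2 * n"
  shows "periodic_label x n (2 * n * a + q) = x q"
proof -
  have "2 * n * a + q + 2 * n - 1 = (q - 1) + 2 * n * Suc a" using assms by simp
  then have "(2 * n * a + q + 2 * n - 1) mod (2 * n) = q - 1"
    using assms by (simp only: mod_mult_self2) simp
  then show ?thesis using assms by (simp add: periodic_label_def)
qed

lemma periodic_label_0: "n \<ge> 1 \<Longrightarrow> periodic_label x n 0 = x (2 * n)"
  by (simp add: periodic_label_def)

lemma periodic_label_shift: "n \<ge> 1 \<Longrightarrow> periodic_label x n (p + 2 * n) = periodic_label x n p"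
proof -
  assume "n \<ge> 1"
  then have "p + 2 * n + 2 * n - 1 = (p + 2 * n - 1) + 2 * n" by simp
  then show ?thesis unfolding periodic_label_def by (simp only: mod_add_self2)
qed

lemma periodic_label_eq_iff:
  assumes x: "inj_on x {1..}" and n: "n \<ge> 1"
  shows "periodic_label x n p = periodic_label x n q \<longleftrightarrow> int (2 * n) dvd int p - int q"
proof -
  have "periodic_label x n p = periodic_label x n q \<longleftrightarrow>
      (p + 2 * n - 1) mod (2 * n) = (q + 2 * n - 1) mod (2 * n)"
    unfolding periodic_label_def using inj_on_eq_iff[OF x] by simp
  also have "\<dots> \<longleftrightarrow> int (2 * n) dvd int (p + 2 * n - 1) - int (q + 2 * n - 1)"
    by (metis mod_eq_dvd_iff of_nat_eq_iff zmod_int)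
  also have "int (p + 2 * n - 1) - int (q + 2 * n - 1) = int p - int q"
    using n by (simp add: of_nat_diff)
  finally show ?thesis .
qed

text \<open>The period is at least four, so a nonzero difference of absolute value at most two is no
  multiple of it.\<close>

lemma periodic_label_neq:
  assumes x: "inj_on x {1..}" and n: "n \<ge> 2" and "p \<noteq> q" "\<bar>int p - int q\<bar> \<le> 2"
  shows "periodic_label x n p \<noteq> periodic_label x n q"
proof
  assume "periodic_label x n p = periodic_label x n q"
  then have "int (2 * n) dvd int p - int q" using periodic_label_eq_iff[OF x] n by simp
  then have "int (2 * n) \<le> \<bar>int p - int q\<bar>" using assms(3) by (intro zdvd_imp_le) auto
  then show False using assms(4) n by linarith
qed

text \<open>The start \<open>s = 1\<close> gives \<alpha> and \<open>s = 0\<close> gives \<beta>,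
  whose extra leaf precedes the first vertex of the path. The roots are 1 and 2 in both
  cases.\<close>

definition path_graph :: "(nat \<Rightarrow> 'a) \<Rightarrow> nat \<Rightarrow> nat \<Rightarrow> 'a rgraph" where
  "path_graph lab s t = RGraph {s..t} {(p, q). p \<in> {s..t} \<and> q \<in> {s..t} \<and> (q = p + 1 \<or> p = q + 1)} lab 1 2"

lemma birooted_tree_path: "s \<le> 1 \<Longrightarrow> t \<ge> 2 \<Longrightarrow> birooted_tree (path_graph lab s t)"
  using is_tree_interval[of s t] unfolding birooted_tree_def path_graph_def by auto

lemma irreducible_path:
  assumes "s \<le> 1" "t \<ge> 2" "\<And>p. lab p \<noteq> lab (p + 1)" "\<And>p. lab p \<noteq> lab (p + 2)"
  shows "irreducible_tree (path_graph lab s t)"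
  unfolding irreducible_tree_def
proof (intro conjI birooted_tree_path assms notI; elim exE)
  fix a assume "nonessential_thorn (path_graph lab s t) a"
  then obtain b where "{v. (a, v) \<in> edges (path_graph lab s t)} = {b}" and lab: "lab a = lab b"
    unfolding nonessential_thorn_def by (auto simp: path_graph_def)
  then have "b \<in> {v. (a, v) \<in> edges (path_graph lab s t)}" by simp
  then have "b = a + 1 \<or> a = b + 1" unfolding path_graph_def by simp
  then show False using lab assms(3)[of a] assms(3)[of b] by auto
next
  fix a b assume "foldable (path_graph lab s t) a b"
  then obtain c where ab: "a \<noteq> b" "lab a = lab b"
    and c: "(a, c) \<in> edges (path_graph lab s t)" "(b, c) \<in> edges (path_graph lab s t)"
    unfolding foldable_def by (auto simp: path_graph_def)
  from c have "(c = a + 1 \<or> a = c + 1) \<and> (c = b + 1 \<or> b = c + 1)" unfolding path_graph_def by simp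
  then have "a = b + 2 \<or> b = a + 2" using ab(1) by auto
  then show False using ab(2) assms(4)[of a] assms(4)[of b] by auto
qed

definition labelled_walk :: "('b \<times> 'b) set \<Rightarrow> ('b \<Rightarrow> 'a) \<Rightarrow> (nat \<Rightarrow> 'a) \<Rightarrow> nat \<Rightarrow> nat \<Rightarrow> (nat \<Rightarrow> 'b) \<Rightarrow> bool" where
  "labelled_walk A L lab s t g \<longleftrightarrow>
    (\<forall>p. s \<le> p \<longrightarrow> p < t \<longrightarrow> (g p, g (Suc p)) \<in> A) \<and> (\<forall>p. s \<le> p \<longrightarrow> p \<le> t \<longrightarrow> L (g p) = lab p)"

lemma labelled_walkD:
  "labelled_walk A L lab s t g \<Longrightarrow> s \<le> p \<Longrightarrow> p < t \<Longrightarrow> (g p, g (Suc p)) \<in> A"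
  "labelled_walk A L lab s t g \<Longrightarrow> s \<le> p \<Longrightarrow> p \<le> t \<Longrightarrow> L (g p) = lab p"
  unfolding labelled_walk_def by blast+

lemma hom_path_iff:
  assumes "folded_graph A L"
  shows "hom A L (path_graph lab s t) g \<longleftrightarrow> labelled_walk A L lab s t g"
proof
  assume "hom A L (path_graph lab s t) g"
  then show "labelled_walk A L lab s t g" unfolding hom_def labelled_walk_def path_graph_def by auto
next
  assume g: "labelled_walk A L lab s t g"
  show "hom A L (path_graph lab s t) g"
  proof (rule homI)
    show "(g u, g v) \<in> A" if "(u, v) \<in> edges (path_graph lab s t)" for u v
    proof -
      have "(s \<le> u \<and> u < t \<and> v = Suc u) \<or> (s \<le> v \<and> v < t \<and> u = Suc v)"
        using that unfolding path_graph_def by auto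
      then show ?thesis using g folded_graph_sym[OF assms] unfolding labelled_walk_def by blast
    qed
    show "L (g v) = label (path_graph lab s t) v" if "v \<in> verts (path_graph lab s t)" for v
      using that g unfolding labelled_walk_def path_graph_def by simp
  qed
qed

lemma rel_path:
  assumes "folded_graph A L"
  shows "rel A L (path_graph lab s t) = {(g 1, g 2) | g. labelled_walk A L lab s t g}"
  unfolding rel_def hom_path_iff[OF assms] by (simp add: path_graph_def)

lemma relabel_path: "relabel f (path_graph lab s t) = path_graph (f \<circ> lab) s t"
  unfolding relabel_def path_graph_def by simp

lemma path_length_ge: "n \<ge> 2 \<Longrightarrow> k \<ge> 1 \<Longrightarrow> 2 * n * k + i \<ge> (4 :: nat)"
  using mult_le_mono[of 4 "2 * n" 1 k] by linarith

text \<open>The two labellings may differ at 0, outside the vertex set, so the identity is used as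
  an isomorphism.\<close>

lemma alpha_tree_eq_path:
  assumes "n \<ge> 2" "k \<ge> 1"
  shows "alpha_tree x n k i = abs_birooted (path_graph (periodic_label x n) 1 (2 * n * k + i))"
proof -
  have B: "birooted_tree (path_graph (periodic_label x n) 1 (2 * n * k + i))"
    using path_length_ge[OF assms, of i] by (intro birooted_tree_path) auto
  have "periodic_label x n p = x ((p - 1) mod (2 * n) + 1)" if "p \<ge> 1" for p
  proof -
    have "p + 2 * n - 1 = (p - 1) + 2 * n" using that by simp
    then show ?thesis unfolding periodic_label_def by (simp only: mod_add_self2)
  qed
  then have "iso_via id (alpha_graph x n k i) (path_graph (periodic_label x n) 1 (2 * n * k + i))"
    unfolding iso_via_def alpha_graph_def path_graph_def by auto
  then have "tree_iso (alpha_graph x n k i) (path_graph (periodic_label x n) 1 (2 * n * k + i))"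
    unfolding tree_iso_def using B birooted_tree_alpha_beta(1)[OF assms] by blast
  then show ?thesis
    unfolding alpha_tree_def using abs_birooted_eq_iff B birooted_tree_alpha_beta(1)[OF assms] by blast
qed

lemma beta_tree_eq_path:
  assumes "n \<ge> 2" "k \<ge> 1"
  shows "beta_tree x n k i = abs_birooted (path_graph (periodic_label x n) 0 (2 * n * k + i))"
proof -
  let ?t = "2 * n * k + i"
  have t: "?t \<ge> 4" using path_length_ge[OF assms] .
  have lab: "(\<lambda>p. x ((p - 1) mod (2 * n) + 1))(0 := x (2 * n)) = periodic_label x n"
  proof
    fix p
    show "((\<lambda>p. x ((p - 1) mod (2 * n) + 1))(0 := x (2 * n))) p = periodic_label x n p"
    proof (cases "p = 0")
      case False
      then have "p + 2 * n - 1 = (p - 1) + 2 * n" by simp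
      then show ?thesis using False unfolding periodic_label_def by (simp only: mod_add_self2) simp
    qed (use assms in \<open>simp add: periodic_label_0\<close>)
  qed
  have "insert 0 {1..?t} = {0..?t}" by auto
  moreover have "{(p, q). p \<in> {1..?t} \<and> q \<in> {1..?t} \<and> (q = p + 1 \<or> p = q + 1)} \<union> {(0, 1), (1, 0)}
      = {(p, q). p \<in> {0..?t} \<and> q \<in> {0..?t} \<and> (q = p + 1 \<or> p = q + 1)}"
    using t by auto
  ultimately have "beta_graph x n k i = path_graph (periodic_label x n) 0 ?t"
    unfolding beta_graph_def alpha_graph_def path_graph_def Let_def rgraph.sel lab by simp
  then show ?thesis unfolding beta_tree_def by simp
qed

lemma brel_path:
  assumes "folded_graph A L" "s \<le> 1" "t \<ge> 2"
  shows "brel A L (abs_birooted (path_graph lab s t)) = {(g 1, g 2) | g. labelled_walk A L lab s t g}"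
  unfolding brel_abs[OF birooted_tree_path[OF assms(2,3)]] by (rule rel_path[OF assms(1)])

lemma periodic_path_in_psl:
  assumes "inj_on x {1..}" "n \<ge> 2" "s \<le> 1" "t \<ge> 2"
  shows "abs_birooted (path_graph (periodic_label x n) s t) \<in> free_psl"
proof -
  have "irreducible_tree (path_graph (periodic_label x n) s t)"
    using assms periodic_label_neq[OF assms(1,2)] by (intro irreducible_path) auto
  then show ?thesis
    unfolding free_psl_def by (simp add: bt_reduced_abs_iff[OF birooted_tree_path[OF assms(3,4)]])
qed

text \<open>If each \<open>s p\<close> is a letter, \<open>zigzag s c p\<close> is the path with vertices \<open>p\<close> to \<open>p + c\<close>; odd vertices
  occur as left roots and even ones as right roots.\<close>

primrec zigzag :: "(nat \<Rightarrow> 'a birooted) \<Rightarrow> nat \<Rightarrow> nat \<Rightarrow> 'a birooted" where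
  "zigzag s 0 p = s p"
| "zigzag s (Suc c) p =
    (if odd p then s p \<and>\<^sub>t zigzag s c (Suc p) else zigzag s c (Suc p) \<and>\<^sub>t s p)"

lemma zigzag_in_psl: "(\<And>p. s p \<in> free_psl) \<Longrightarrow> zigzag s c p \<in> free_psl"
  by (cases c) (simp_all add: psl_meet_in_psl)

section \<open>Relations of zigzag terms\<close>

lemma psl_endo_meet:
  "psl_endo \<phi> \<Longrightarrow> \<gamma> \<in> free_psl \<Longrightarrow> \<delta> \<in> free_psl \<Longrightarrow> \<phi> (\<gamma> \<and>\<^sub>t \<delta>) = \<phi> \<gamma> \<and>\<^sub>t \<phi> \<delta>"
  unfolding psl_endo_def by blast

lemma psl_endo_in_psl: "psl_endo \<phi> \<Longrightarrow> \<gamma> \<in> free_psl \<Longrightarrow> \<phi> \<gamma> \<in> free_psl"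
  unfolding psl_endo_def by blast

lemma psl_endo_zigzag:
  assumes "psl_endo \<phi>" "\<And>p. s p \<in> free_psl"
  shows "\<phi> (zigzag s c p) = zigzag (\<lambda>q. \<phi> (s q)) c p"
  by (induction c arbitrary: p) (simp_all add: psl_endo_meet[OF assms(1)] zigzag_in_psl assms(2))

text \<open>The possible images of the vertex \<open>p\<close>: factors at odd positions contribute
  left roots, those at even positions right roots.\<close>

definition root_set :: "('b \<times> 'b) set \<Rightarrow> ('b \<Rightarrow> 'a) \<Rightarrow> (nat \<Rightarrow> 'a birooted) \<Rightarrow> nat \<Rightarrow> 'b set" where
  "root_set A L s p = (if odd p then Domain (brel A L (s p)) else Range (brel A L (s p)))"

definition set_walk :: "('b \<times> 'b) set \<Rightarrow> (nat \<Rightarrow> 'b set) \<Rightarrow> nat \<Rightarrow> nat \<Rightarrow> (nat \<Rightarrow> 'b) \<Rightarrow> bool" where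
  "set_walk A X s t g \<longleftrightarrow>
    (\<forall>p. s \<le> p \<longrightarrow> p < t \<longrightarrow> (g p, g (Suc p)) \<in> A) \<and> (\<forall>p. s \<le> p \<longrightarrow> p \<le> t \<longrightarrow> g p \<in> X p)"

lemma set_walk_Cons:
  assumes "set_walk A X (Suc p) t g" "u \<in> X p" "(u, g (Suc p)) \<in> A"
  shows "set_walk A X p t (g(p := u))"
  unfolding set_walk_def
proof (intro conjI allI impI)
  fix q assume "p \<le> q" "q < t"
  then show "((g(p := u)) q, (g(p := u)) (Suc q)) \<in> A"
    using assms unfolding set_walk_def by (cases "q = p") auto
next
  fix q assume "p \<le> q" "q \<le> t"
  then show "(g(p := u)) q \<in> X q"
    using assms unfolding set_walk_def by (cases "q = p") auto
qed

lemma set_walk_Suc: "set_walk A X p t g \<Longrightarrow> set_walk A X (Suc p) t g"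
  unfolding set_walk_def by simp

text \<open>Each meet selects those vertices of the first set that have a neighbour in the root set
  of the remaining term; iterating this produces a walk.\<close>

lemma root_set_zigzag:
  assumes A: "folded_graph A L"
  shows "root_set A L (zigzag s c) p = {g p | g. set_walk A (root_set A L s) p (p + c) g}"
proof (induction c arbitrary: p)
  case 0
  show ?case unfolding set_walk_def by (auto simp: root_set_def)
next
  case (Suc c)
  have "root_set A L (zigzag s (Suc c)) p =
      {u \<in> root_set A L s p. \<exists>v \<in> root_set A L (zigzag s c) (Suc p). (u, v) \<in> A}"
    using folded_graph_sym[OF A] by (auto simp: root_set_def brel_meet[OF A])
  also have "\<dots> = {g p | g. set_walk A (root_set A L s) p (p + Suc c) g}" (is "?L = ?R")
  proof
    show "?L \<subseteq> ?R"
    proof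
      fix u assume "u \<in> ?L"
      then obtain g where u: "u \<in> root_set A L s p" "(u, g (Suc p)) \<in> A"
        and g: "set_walk A (root_set A L s) (Suc p) (Suc p + c) g"
        unfolding Suc.IH by auto
      from set_walk_Cons[OF g u] show "u \<in> ?R" by (auto intro!: exI[of _ "g(p := u)"])
    qed
    show "?R \<subseteq> ?L"
    proof
      fix u assume "u \<in> ?R"
      then obtain g where g: "u = g p" "set_walk A (root_set A L s) p (p + Suc c) g" by blast
      then have "set_walk A (root_set A L s) (Suc p) (Suc p + c) g" using set_walk_Suc by fastforce
      then have "g (Suc p) \<in> root_set A L (zigzag s c) (Suc p)" unfolding Suc.IH by blast
      moreover have "g p \<in> root_set A L s p" "(g p, g (Suc p)) \<in> A"
        using g(2) unfolding set_walk_def by simp_all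
      ultimately show "u \<in> ?L" using g(1) by blast
    qed
  qed
  finally show ?case .
qed

lemma Range_zigzag_2:
  assumes "folded_graph A L"
  shows "Range (brel A L (zigzag s c 2)) = {g 2 | g. set_walk A (root_set A L s) 2 (2 + c) g}"
  using root_set_zigzag[OF assms, of s c 2] by (simp add: root_set_def)

lemma brel_zigzag:
  assumes "folded_graph A L"
  shows "brel A L (zigzag s (Suc c) 1) =
    {(u, v) \<in> A. u \<in> root_set A L s 1 \<and> (\<exists>g. set_walk A (root_set A L s) 2 (2 + c) g \<and> v = g 2)}"
proof -
  have "zigzag s (Suc c) 1 = s 1 \<and>\<^sub>t zigzag s c 2" by (simp add: numeral_2_eq_2)
  then show ?thesis
    by (auto simp: root_set_def brel_meet[OF assms] Range_zigzag_2[OF assms])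
qed

text \<open>The factor \<open>s 1 \<and>\<^sub>t s 0\<close> demands that the left root have a
  neighbour in the root set of position 0; this neighbour is the image of the extra leaf.\<close>

lemma brel_zigzag_leaf:
  assumes "folded_graph A L"
  shows "brel A L ((s 1 \<and>\<^sub>t s 0) \<and>\<^sub>t zigzag s c 2) =
    {(u, v) \<in> A. u \<in> root_set A L s 1 \<and> (\<exists>z \<in> root_set A L s 0. (u, z) \<in> A) \<and>
      (\<exists>g. set_walk A (root_set A L s) 2 (2 + c) g \<and> v = g 2)}"
  by (auto simp: root_set_def brel_meet[OF assms] Range_zigzag_2[OF assms])

lemma labelled_walk_iff_set_walk:
  assumes A: "folded_graph A L" and "s < t"
  shows "labelled_walk A L lab s t g \<longleftrightarrow> set_walk A (root_set A L (\<lambda>p. letter (lab p))) s t g"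
proof -
  have X: "root_set A L (\<lambda>p. letter (lab p)) p = {u \<in> Field A. L u = lab p}" for p
    by (simp add: root_set_def brel_letter[OF A])
  have "g p \<in> Field A"
    if "\<And>p. s \<le> p \<Longrightarrow> p < t \<Longrightarrow> (g p, g (Suc p)) \<in> A" "s \<le> p" "p \<le> t" for p
  proof (cases "p < t")
    case True
    then show ?thesis using that by (blast intro: FieldI1)
  next
    case False
    then obtain q where "p = Suc q" "s \<le> q" "q < t" using \<open>p \<le> t\<close> assms(2) by (cases p) auto
    then show ?thesis using that(1) by (blast intro: FieldI2)
  qed
  then show ?thesis unfolding labelled_walk_def set_walk_def X by auto
qed

text \<open>Writing \<alpha> and \<beta> as terms in letters allows an arbitrary endomorphism to be
  applied letter by letter.\<close>

lemma path_eq_zigzag: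
  fixes x :: "nat \<Rightarrow> 'a"
  assumes x: "inj_on x {1..}" "n \<ge> 2"
  defines "s \<equiv> \<lambda>p. letter (periodic_label x n p)"
  shows "abs_birooted (path_graph (periodic_label x n) 1 (2 + Suc c)) = zigzag s (Suc (Suc c)) 1"
    and "abs_birooted (path_graph (periodic_label x n) 0 (2 + Suc c)) = (s 1 \<and>\<^sub>t s 0) \<and>\<^sub>t zigzag s (Suc c) 2"
proof -
  have s: "s p \<in> free_psl" for p unfolding s_def by (rule letter_in_psl)
  have split: "(g 1, g 2) \<in> A \<and> g 1 \<in> root_set A L s 1 \<and> set_walk A (root_set A L s) 2 (2 + Suc c) g"
    if "set_walk A (root_set A L s) 1 (2 + Suc c) g" for A :: "('a list \<times> 'a list) set" and L g
    using that set_walk_Suc[OF that] unfolding set_walk_def by (auto simp: numeral_2_eq_2)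
  show "abs_birooted (path_graph (periodic_label x n) 1 (2 + Suc c)) = zigzag s (Suc (Suc c)) 1"
  proof (rule psl_eqI)
    fix A :: "('a list \<times> 'a list) set" and L :: "'a list \<Rightarrow> 'a"
    assume A: "folded_graph A L"
    have "brel A L (abs_birooted (path_graph (periodic_label x n) 1 (2 + Suc c))) =
        {(g 1, g 2) | g. set_walk A (root_set A L s) 1 (2 + Suc c) g}"
      using brel_path[OF A] labelled_walk_iff_set_walk[OF A] unfolding s_def by auto
    also have "\<dots> = {(u, v) \<in> A. u \<in> root_set A L s 1 \<and>
        (\<exists>g. set_walk A (root_set A L s) 2 (2 + Suc c) g \<and> v = g 2)}" (is "?L = ?R")
    proof
      show "?L \<subseteq> ?R" using split by blast
      show "?R \<subseteq> ?L"
      proof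
        fix e assume "e \<in> ?R"
        then obtain u g where e: "e = (u, g 2)" "(u, g 2) \<in> A" "u \<in> root_set A L s 1"
          and g: "set_walk A (root_set A L s) 2 (2 + Suc c) g" by blast
        have "set_walk A (root_set A L s) 1 (2 + Suc c) (g(1 := u))"
          by (rule set_walk_Cons) (use e g in \<open>simp_all add: numeral_2_eq_2\<close>)
        moreover have "e = ((g(1 := u)) 1, (g(1 := u)) 2)" using e(1) by simp
        ultimately show "e \<in> ?L" by blast
      qed
    qed
    also have "\<dots> = brel A L (zigzag s (Suc (Suc c)) 1)" by (rule brel_zigzag[OF A, symmetric])
    finally show "brel A L (abs_birooted (path_graph (periodic_label x n) 1 (2 + Suc c))) =
        brel A L (zigzag s (Suc (Suc c)) 1)" .
  qed (rule periodic_path_in_psl[OF x] zigzag_in_psl[OF s]; simp)+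
  show "abs_birooted (path_graph (periodic_label x n) 0 (2 + Suc c)) = (s 1 \<and>\<^sub>t s 0) \<and>\<^sub>t zigzag s (Suc c) 2"
  proof (rule psl_eqI)
    fix A :: "('a list \<times> 'a list) set" and L :: "'a list \<Rightarrow> 'a"
    assume A: "folded_graph A L"
    have "brel A L (abs_birooted (path_graph (periodic_label x n) 0 (2 + Suc c))) =
        {(g 1, g 2) | g. set_walk A (root_set A L s) 0 (2 + Suc c) g}"
      using brel_path[OF A] labelled_walk_iff_set_walk[OF A] unfolding s_def by auto
    also have "\<dots> = {(u, v) \<in> A. u \<in> root_set A L s 1 \<and> (\<exists>z \<in> root_set A L s 0. (u, z) \<in> A) \<and>
        (\<exists>g. set_walk A (root_set A L s) 2 (2 + Suc c) g \<and> v = g 2)}" (is "?L = ?R")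
    proof
      show "?L \<subseteq> ?R"
      proof
        fix e assume "e \<in> ?L"
        then obtain g where g: "e = (g 1, g 2)" "set_walk A (root_set A L s) 0 (2 + Suc c) g" by blast
        then have "set_walk A (root_set A L s) 1 (2 + Suc c) g" using set_walk_Suc by fastforce
        moreover have "g 0 \<in> root_set A L s 0" "(g 0, g 1) \<in> A" using g(2) unfolding set_walk_def by auto
        ultimately show "e \<in> ?R" using split folded_graph_sym[OF A] g(1) by blast
      qed
      show "?R \<subseteq> ?L"
      proof
        fix e assume "e \<in> ?R"
        then obtain u z g where e: "e = (u, g 2)" "(u, g 2) \<in> A" "u \<in> root_set A L s 1"
          and z: "z \<in> root_set A L s 0" "(u, z) \<in> A"
          and g: "set_walk A (root_set A L s) 2 (2 + Suc c) g" by blast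
        have "set_walk A (root_set A L s) 1 (2 + Suc c) (g(1 := u))"
          by (rule set_walk_Cons) (use e g in \<open>simp_all add: numeral_2_eq_2\<close>)
        then have "set_walk A (root_set A L s) 0 (2 + Suc c) (g(1 := u, 0 := z))"
          by (intro set_walk_Cons) (use z folded_graph_sym[OF A] in simp_all)
        moreover have "e = ((g(1 := u, 0 := z)) 1, (g(1 := u, 0 := z)) 2)" using e(1) by simp
        ultimately show "e \<in> ?L" by blast
      qed
    qed
    also have "\<dots> = brel A L ((s 1 \<and>\<^sub>t s 0) \<and>\<^sub>t zigzag s (Suc c) 2)"
      by (rule brel_zigzag_leaf[OF A, symmetric])
    finally show "brel A L (abs_birooted (path_graph (periodic_label x n) 0 (2 + Suc c))) =
        brel A L ((s 1 \<and>\<^sub>t s 0) \<and>\<^sub>t zigzag s (Suc c) 2)" .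
  qed (rule periodic_path_in_psl[OF x] psl_meet_in_psl; simp)+
qed

section \<open>Walks on a path with thorns\<close>

text \<open>The vertex \<open>(p, True)\<close> is the thorn at \<open>(p, False)\<close>.\<close>

definition fence_adj :: "nat \<Rightarrow> ((nat \<times> bool) \<times> (nat \<times> bool)) set" where
  "fence_adj t = {((p, b), (q, c)). p \<in> {1..t} \<and> q \<in> {1..t} \<and>
     ((\<not> b \<and> \<not> c \<and> (q = Suc p \<or> p = Suc q)) \<or> (p = q \<and> b \<noteq> c))}"

lemma fence_adj_iff:
  "((p, b), (q, c)) \<in> fence_adj t \<longleftrightarrow> 1 \<le> p \<and> p \<le> t \<and> 1 \<le> q \<and> q \<le> t \<and>
     ((\<not> b \<and> \<not> c \<and> (q = Suc p \<or> p = Suc q)) \<or> (p = q \<and> b \<noteq> c))"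
  unfolding fence_adj_def by auto

text \<open>The last claim says that the fence is bipartite: comparing the parity of the position
  with the thorn flag gives a two-colouring.\<close>

lemma fence_adjD:
  assumes "(v, w) \<in> fence_adj t"
  shows "1 \<le> fst v" "fst v \<le> t" "1 \<le> fst w" "fst w \<le> t" "\<bar>int (fst w) - int (fst v)\<bar> \<le> 1"
    "(even (fst w) = snd w) \<longleftrightarrow> \<not> (even (fst v) = snd v)"
  using assms by (cases v; cases w; auto simp: fence_adj_iff)+

text \<open>Two neighbours of one vertex are at most two positions apart, so equal labels force
  equal positions, and then the two-colouring forces equal thorn flags.\<close>

lemma folded_fence:
  assumes "inj_on x {1..}" "m \<ge> 2"
  shows "folded_graph (fence_adj t) (\<lambda>v. periodic_label x m (fst v))"
  unfolding folded_graph_def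
proof (intro conjI allI impI ballI)
  show "sym (fence_adj t)" unfolding sym_def fence_adj_def by auto
next
  fix u v w
  assume uv: "(u, v) \<in> fence_adj t" and uw: "(u, w) \<in> fence_adj t"
    and l: "periodic_label x m (fst v) = periodic_label x m (fst w)"
  have "\<bar>int (fst v) - int (fst w)\<bar> \<le> 2" using fence_adjD(5)[OF uv] fence_adjD(5)[OF uw] by linarith
  then have "fst v = fst w" using periodic_label_neq[OF assms] l by blast
  moreover have "snd v = snd w" using fence_adjD(6)[OF uv] fence_adjD(6)[OF uw] calculation by auto
  ultimately show "v = w" by (rule prod_eqI)
next
  fix u assume "u \<in> Field (fence_adj t)"
  then obtain v where "(u, v) \<in> fence_adj t \<or> (v, u) \<in> fence_adj t" unfolding Field_def by blast
  then have "1 \<le> fst u" "fst u \<le> t" using fence_adjD(1-4) by blast+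
  then have "(u, (fst u, \<not> snd u)) \<in> fence_adj t" by (cases u) (simp add: fence_adj_iff)
  then show "\<exists>v. (u, v) \<in> fence_adj t \<and> periodic_label x m (fst v) = periodic_label x m (fst u)"
    by (intro exI[of _ "(fst u, \<not> snd u)"]) simp
qed

lemma multiple_small_eq_0:
  fixes d e :: int
  assumes "d dvd e" "\<bar>e\<bar> < d"
  shows "e = 0"
  using assms zdvd_imp_le[of d "\<bar>e\<bar>"] by (cases "e = 0") auto

text \<open>The displacement over one period of a walk whose labels have period \<open>2 * n\<close> is a
  multiple of \<open>2 * m\<close> and does not depend on the starting point. If it is nonzero, then the
  walk covers too many vertices unless the stated condition holds.\<close>

lemma periodic_fence_walk:
  fixes w :: "nat \<Rightarrow> nat \<times> bool" and n m k l i j :: nat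
  defines "t \<equiv> 2 * m * l + j"
  assumes x: "inj_on x {1..}" and m: "m \<ge> 2" and n: "n \<ge> 2" and k: "k \<ge> 1" and i: "1 \<le> i" "i \<le> 2 * n"
    and j: "j \<le> 2 * m"
    and w: "\<And>q. 1 \<le> q \<Longrightarrow> q < 2 * n * k + i \<Longrightarrow> (w q, w (Suc q)) \<in> fence_adj t"
    and lab: "\<And>q. 1 \<le> q \<Longrightarrow> q + 2 * n \<le> 2 * n * k + i \<Longrightarrow>
        periodic_label x m (fst (w (q + 2 * n))) = periodic_label x m (fst (w q))"
    and fail: "\<not> ((n \<ge> m \<and> l > k) \<or> (n \<ge> m \<and> l = k \<and> int j \<ge> int i + 2 * int m - 2 * int n))"
  shows "w (2 * n + 1) = w 1"
proof -
  let ?K = "2 * n * k + i"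
  define a where "a q = int (fst (w q))" for q
  define D where "D q = a (q + 2 * n) - a q" for q
  have nk: "2 * n \<le> 2 * n * k" using k by simp
  have K: "?K \<ge> 2 * n + 1" using nk i by linarith
  have bnd: "1 \<le> a q \<and> a q \<le> int t" if "1 \<le> q" "q \<le> ?K" for q
  proof (cases "q < ?K")
    case True
    then show ?thesis using fence_adjD(1,2)[OF w[OF that(1) True]] by (simp add: a_def)
  next
    case False
    then have "q = Suc (q - 1)" and r: "1 \<le> q - 1" "q - 1 < ?K" using that K n by linarith+
    then show ?thesis using fence_adjD(3,4)[OF w[OF r]] by (simp add: a_def)
  qed
  have step: "\<bar>a (Suc q) - a q\<bar> \<le> 1" if "1 \<le> q" "q < ?K" for q
    using fence_adjD(5)[OF w[OF that]] by (simp add: a_def)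
  have steps: "\<bar>a (q + r) - a q\<bar> \<le> int r" if "1 \<le> q" "q + r \<le> ?K" for q r
    using that(2)
  proof (induction r)
    case (Suc r)
    then have "\<bar>a (q + r) - a q\<bar> \<le> int r" by simp
    then show ?case using step[of "q + r"] that(1) Suc.prems by simp
  qed simp
  have dvd: "2 * int m dvd D q" if "1 \<le> q" "q + 2 * n \<le> ?K" for q
    using lab[OF that] periodic_label_eq_iff[OF x, of m] m by (simp add: D_def a_def)
  \<comment> \<open>The displacement \<open>D\<close> changes by at most two per step and by a
    multiple of \<open>2 * m\<close>, which is at least four, hence not at all.\<close>
  have D_Suc: "D (Suc q) = D q" if "1 \<le> q" "Suc q + 2 * n \<le> ?K" for q
  proof -
    have "D (Suc q) - D q = (a (Suc (q + 2 * n)) - a (q + 2 * n)) - (a (Suc q) - a q)"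
      by (simp add: D_def)
    then have "\<bar>D (Suc q) - D q\<bar> \<le> 2" using step[of "q + 2 * n"] step[of q] that by simp
    moreover have "2 * int m dvd D (Suc q) - D q"
      using dvd[of q] dvd[of "Suc q"] that by (intro dvd_diff) simp_all
    ultimately have "D (Suc q) - D q = 0" using m by (intro multiple_small_eq_0[of "2 * int m"]) auto
    then show ?thesis by simp
  qed
  have D_const: "D q = D 1" if "1 \<le> q" "q + 2 * n \<le> ?K" for q
    using that
  proof (induction q rule: dec_induct)
    case (step q)
    then show ?case using D_Suc[of q] by simp
  qed simp
  have shift: "a (q + 2 * n * r) = a q + int r * D 1" if "1 \<le> q" "q + 2 * n * r \<le> ?K" for q r
    using that(2)
  proof (induction r)
    case (Suc r)
    have eq: "q + 2 * n * Suc r = (q + 2 * n * r) + 2 * n" by simp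
    then have "a (q + 2 * n * Suc r) = a (q + 2 * n * r) + D (q + 2 * n * r)" by (simp only: D_def)
    also have "D (q + 2 * n * r) = D 1" using Suc.prems eq that(1) by (intro D_const) linarith+
    also have "a (q + 2 * n * r) = a q + int r * D 1" using Suc.IH Suc.prems eq by linarith
    finally show ?case by (simp add: algebra_simps)
  qed simp
  \<comment> \<open>An even number of steps preserves the colour. So if the positions one period
    apart agree, the thorn flags agree as well.\<close>
  have parity: "(even (fst (w (1 + 2 * r))) = snd (w (1 + 2 * r))) = (even (fst (w 1)) = snd (w 1))"
    if "1 + 2 * r \<le> ?K" for r
    using that
  proof (induction r)
    case (Suc r)
    have "1 + 2 * r \<le> ?K" using Suc.prems by simp
    moreover have "(w (1 + 2 * r), w (Suc (1 + 2 * r))) \<in> fence_adj t"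
      "(w (Suc (1 + 2 * r)), w (1 + 2 * Suc r)) \<in> fence_adj t"
      using w[of "1 + 2 * r"] w[of "Suc (1 + 2 * r)"] Suc.prems by auto
    ultimately show ?case using Suc.IH fence_adjD(6) by blast
  qed simp
  show ?thesis
  proof (cases "D 1 = 0")
    case True
    then have "fst (w (2 * n + 1)) = fst (w 1)" by (simp add: D_def a_def)
    moreover have "(even (fst (w (2 * n + 1))) = snd (w (2 * n + 1))) = (even (fst (w 1)) = snd (w 1))"
      using parity[of n] K by simp
    ultimately show ?thesis by (intro prod_eqI) auto
  next
    case False
    have d: "\<bar>D 1\<bar> \<ge> 2 * int m"
      using zdvd_imp_le[of "2 * int m" "\<bar>D 1\<bar>"] dvd[of 1] False K by simp
    have "\<bar>D 1\<bar> \<le> 2 * int n" using steps[of 1 "2 * n"] K by (simp add: D_def)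
    then have mn: "m \<le> n" using d by linarith
    have mult: "int r * (2 * int m) \<le> \<bar>int r * D 1\<bar>" for r
      using mult_left_mono[OF d, of "int r"] by (simp add: abs_mult)
    \<comment> \<open>From position 1, \<open>k\<close> full periods fit because
      \<open>i \<ge> 1\<close>. They move the walk by at least \<open>2 * m * k\<close>, while there
      is room for at most \<open>t - 1\<close>; this gives \<open>k \<le> l\<close>.\<close>
    have "a (1 + 2 * n * k) = a 1 + int k * D 1" using shift[of 1 k] i by simp
    then have "\<bar>int k * D 1\<bar> \<le> int t - 1" using bnd[of 1] bnd[of "1 + 2 * n * k"] i by linarith
    then have "int k * (2 * int m) \<le> 2 * int m * int l + int j - 1"
      using mult[of k] unfolding t_def by simp
    also have "\<dots> < int (Suc l) * (2 * int m)" using j by (simp add: algebra_simps)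
    finally have "int k < int (Suc l)" using m by (simp only: mult_less_cancel_right)
    then have kl: "l = k" and lt: "int j < int i + 2 * int m - 2 * int n" using fail mn by auto
    \<comment> \<open>The displacement of \<open>k + 1\<close> periods is that from 1 to the last
      position \<open>i + 2 * n * k\<close>, bounded by the room \<open>t - 1\<close>, plus
      \<open>a (1 + 2 * n) - a i\<close>, bounded by the number of steps.\<close>
    have "\<bar>a (1 + 2 * n) - a i\<bar> \<le> int (1 + 2 * n - i)"
      using steps[of i "1 + 2 * n - i"] i K by simp
    moreover have "a (1 + 2 * n) = a 1 + D 1" by (simp add: D_def add.commute)
    moreover have "a (i + 2 * n * k) = a i + int k * D 1" using shift[of i k] i by simp
    moreover have "int (Suc k) * D 1 = D 1 + int k * D 1" by (simp add: algebra_simps)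
    ultimately have "\<bar>int (Suc k) * D 1\<bar> \<le> int t - 1 + int (1 + 2 * n - i)"
      using bnd[of 1] bnd[of "i + 2 * n * k"] i by linarith
    then have "int (Suc k) * (2 * int m) \<le> int t - 1 + int (1 + 2 * n - i)" using mult[of "Suc k"] by linarith
    then have False using lt kl i unfolding t_def by (simp add: algebra_simps of_nat_diff)
    then show ?thesis ..
  qed
qed

section \<open>Separation of the pairs when the condition fails\<close>

lemma brel_labels:
  "\<exists>a. \<forall>u \<in> Domain (brel A L \<gamma>). L u = a" "\<exists>a. \<forall>u \<in> Range (brel A L \<gamma>). L u = a"
proof -
  obtain T where T: "birooted_tree T" "\<gamma> = abs_birooted T" by (rule birooted_cases)
  have "\<forall>u \<in> Domain (brel A L \<gamma>). L u = label T (lroot T)"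
    "\<forall>u \<in> Range (brel A L \<gamma>). L u = label T (rroot T)"
    unfolding T(2) brel_abs[OF T(1)]
    using birooted_treeD(8,9)[OF T(1)] by (auto elim!: relE intro: hom_label)
  then show "\<exists>a. \<forall>u \<in> Domain (brel A L \<gamma>). L u = a" "\<exists>a. \<forall>u \<in> Range (brel A L \<gamma>). L u = a" by blast+
qed

text \<open>An endomorphism may send a letter to any tree, but the images of a root still share one
  label. Applied to positions \<open>2 * n\<close> apart, this makes the labels along a walk
  periodic.\<close>

lemma root_set_label:
  assumes "u \<in> root_set A L s p" "v \<in> root_set A L s q" "even p = even q" "s p = s q"
  shows "L u = L v"
  using assms brel_labels[of A L "s q"] unfolding root_set_def by (auto split: if_splits)

definition endo_kernel :: "('b \<times> 'b) set \<Rightarrow> ('b \<Rightarrow> 'a) \<Rightarrow> ('a birooted \<times> 'a birooted) set" where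
  "endo_kernel A L = {(\<gamma>, \<delta>). \<gamma> \<in> free_psl \<and> \<delta> \<in> free_psl \<and>
     (\<forall>\<phi>. psl_endo \<phi> \<longrightarrow> brel A L (\<phi> \<gamma>) = brel A L (\<phi> \<delta>))}"

lemma psl_congruence_endo_kernel:
  assumes "folded_graph A L"
  shows "psl_congruence (endo_kernel A L)"
  unfolding psl_congruence_def
proof (intro conjI allI impI)
  show "equiv free_psl (endo_kernel A L)"
    unfolding endo_kernel_def by (rule equivI) (auto simp: refl_on_def sym_def trans_def)
next
  fix \<alpha> \<alpha>' \<beta> \<beta>' assume "(\<alpha>, \<alpha>') \<in> endo_kernel A L" "(\<beta>, \<beta>') \<in> endo_kernel A L"
  then show "(\<alpha> \<and>\<^sub>t \<beta>, \<alpha>' \<and>\<^sub>t \<beta>') \<in> endo_kernel A L"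
    unfolding endo_kernel_def by (simp add: psl_meet_in_psl psl_endo_meet brel_meet[OF assms])
qed

lemma fully_invariant_endo_kernel:
  fixes L :: "'b \<Rightarrow> 'a"
  shows "fully_invariant (endo_kernel A L)"
  unfolding fully_invariant_def
proof (intro allI impI, clarify)
  fix \<phi> :: "'a birooted \<Rightarrow> 'a birooted" and \<gamma> \<delta>
  assume \<phi>: "psl_endo \<phi>" and k: "(\<gamma>, \<delta>) \<in> endo_kernel A L"
  have "brel A L (\<psi> (\<phi> \<gamma>)) = brel A L (\<psi> (\<phi> \<delta>))" if "psl_endo \<psi>" for \<psi>
  proof -
    have "psl_endo (\<lambda>\<gamma>. \<psi> (\<phi> \<gamma>))" using \<phi> that unfolding psl_endo_def by (auto simp: Pi_iff)
    then show ?thesis using k unfolding endo_kernel_def by blast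
  qed
  then show "(\<phi> \<gamma>, \<phi> \<delta>) \<in> endo_kernel A L"
    using k psl_endo_in_psl[OF \<phi>] unfolding endo_kernel_def by blast
qed

lemma is_consequenceD:
  "is_consequence \<sigma> \<tau> \<Longrightarrow> psl_congruence \<theta> \<Longrightarrow> fully_invariant \<theta> \<Longrightarrow> \<tau> \<in> \<theta> \<Longrightarrow> \<sigma> \<in> \<theta>"
  unfolding is_consequence_def fi_congruence_generated_def by blast

text \<open>After an endomorphism both terms ask for a walk \<open>w\<close> through the root sets,
  and \<beta> asks in addition for a neighbour of \<open>w 1\<close> in the root set of position 0.
  By \<open>periodic_fence_walk\<close> the walk is back at \<open>w 1\<close> at position
  \<open>2 * n + 1\<close>, so \<open>w (2 * n)\<close> is such a neighbour: positions 0 and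
  \<open>2 * n\<close> have the same parity and the same term.\<close>

lemma alpha_beta_in_endo_kernel:
  fixes x :: "nat \<Rightarrow> 'a" and n m k l i j :: nat
  assumes x: "inj_on x {1..}" and n: "n \<ge> 2" and m: "m \<ge> 2" and k: "k \<ge> 1"
    and i: "1 \<le> i" "i \<le> 2 * n" and j: "j \<le> 2 * m"
    and fail: "\<not> ((n \<ge> m \<and> l > k) \<or> (n \<ge> m \<and> l = k \<and> int j \<ge> int i + 2 * int m - 2 * int n))"
  shows "(alpha_tree x n k i, beta_tree x n k i)
    \<in> endo_kernel (fence_adj (2 * m * l + j)) (\<lambda>v. periodic_label x m (fst v))"
proof -
  let ?A = "fence_adj (2 * m * l + j)" and ?L = "\<lambda>v. periodic_label x m (fst v)"
  let ?K = "2 * n * k + i"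
  note A = folded_fence[OF x m, of "2 * m * l + j"]
  define s where "s p = letter (periodic_label x n p)" for p
  \<comment> \<open>The path has \<open>2 + Suc c\<close> vertices after position 0, the form
    required by \<open>path_eq_zigzag\<close>; the subtraction is exact because there are at least
    four.\<close>
  define c where "c = ?K - 3"
  have K: "?K = 2 + Suc c" using path_length_ge[OF n k, of i] by (simp add: c_def)
  have alpha: "alpha_tree x n k i = zigzag s (Suc (Suc c)) 1"
    and beta: "beta_tree x n k i = (s 1 \<and>\<^sub>t s 0) \<and>\<^sub>t zigzag s (Suc c) 2"
    unfolding alpha_tree_eq_path[OF n k] beta_tree_eq_path[OF n k] K s_def
    by (rule path_eq_zigzag[OF x n])+
  have s: "s p \<in> free_psl" for p unfolding s_def by (rule letter_in_psl)
  have per: "s (p + 2 * n) = s p" for p using n by (simp add: s_def periodic_label_shift)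
  have "brel ?A ?L (\<phi> (alpha_tree x n k i)) = brel ?A ?L (\<phi> (beta_tree x n k i))" if \<phi>: "psl_endo \<phi>" for \<phi>
  proof -
    define s' where "s' p = \<phi> (s p)" for p
    let ?X = "root_set ?A ?L s'"
    have per': "s' (p + 2 * n) = s' p" for p by (simp add: s'_def per)
    have a: "\<phi> (alpha_tree x n k i) = zigzag s' (Suc (Suc c)) 1"
      unfolding alpha s'_def by (rule psl_endo_zigzag[OF \<phi> s])
    have b: "\<phi> (beta_tree x n k i) = (s' 1 \<and>\<^sub>t s' 0) \<and>\<^sub>t zigzag s' (Suc c) 2"
      unfolding beta s'_def
      by (simp only: psl_endo_meet[OF \<phi>] psl_meet_in_psl zigzag_in_psl[of s, OF s] s psl_endo_zigzag[OF \<phi> s])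
    have "\<exists>z \<in> ?X 0. (u, z) \<in> ?A"
      if u: "u \<in> ?X 1" "(u, g 2) \<in> ?A" and g: "set_walk ?A ?X 2 (2 + Suc c) g" for u g
    proof -
      define w where "w = g(1 := u)"
      have w: "set_walk ?A ?X 1 ?K w"
        unfolding w_def K by (rule set_walk_Cons) (use u g in \<open>simp_all add: numeral_2_eq_2\<close>)
      then have w1: "(w q, w (Suc q)) \<in> ?A" if "1 \<le> q" "q < ?K" for q
        using that unfolding set_walk_def by blast
      have w2: "w q \<in> ?X q" if "1 \<le> q" "q \<le> ?K" for q using that w unfolding set_walk_def by blast
      have nk: "2 * n \<le> 2 * n * k" using k by simp
      have w3: "periodic_label x m (fst (w (q + 2 * n))) = periodic_label x m (fst (w q))"
        if "1 \<le> q" "q + 2 * n \<le> ?K" for q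
        by (rule root_set_label[OF w2 w2]) (use that per' in auto)
      have "w (2 * n + 1) = w 1" by (rule periodic_fence_walk[OF x m n k i j w1 w3 fail])
      moreover have "(w (2 * n), w (Suc (2 * n))) \<in> ?A" using nk i n by (intro w1) linarith+
      ultimately have "(u, w (2 * n)) \<in> ?A" using folded_graph_sym[OF A] by (simp add: w_def)
      moreover have "w (2 * n) \<in> ?X (2 * n)" using nk i n by (intro w2) linarith+
      then have "w (2 * n) \<in> ?X 0" using per'[of 0] by (simp add: root_set_def)
      ultimately show ?thesis by blast
    qed
    then show ?thesis
      unfolding a b brel_zigzag[OF A] brel_zigzag_leaf[OF A] by blast
  qed
  moreover have "alpha_tree x n k i \<in> free_psl" unfolding alpha by (rule zigzag_in_psl[OF s])
  moreover have "beta_tree x n k i \<in> free_psl" unfolding beta by (rule psl_meet_in_psl)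
  ultimately show ?thesis unfolding endo_kernel_def by blast
qed

text \<open>Already the identity endomorphism separates the pair. The inclusion of the path
  witnesses a pair in the relation of \<alpha>. For \<beta>, the first vertex would need a neighbour
  with the label of position 0, but its neighbours lie at positions 1 and 2.\<close>

lemma alpha_beta_not_in_endo_kernel:
  fixes x :: "nat \<Rightarrow> 'a"
  assumes x: "inj_on x {1..}" and m: "m \<ge> 2" and l: "l \<ge> 1"
  shows "(alpha_tree x m l j, beta_tree x m l j)
    \<notin> endo_kernel (fence_adj (2 * m * l + j)) (\<lambda>v. periodic_label x m (fst v))"
proof
  let ?t = "2 * m * l + j"
  let ?A = "fence_adj ?t" and ?L = "\<lambda>v. periodic_label x m (fst v)"
  note A = folded_fence[OF x m, of ?t]
  have t: "?t \<ge> 4" using path_length_ge[OF m l] .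
  have brel: "brel ?A ?L (alpha_tree x m l j) = {(g 1, g 2) | g. labelled_walk ?A ?L (periodic_label x m) 1 ?t g}"
    "brel ?A ?L (beta_tree x m l j) = {(g 1, g 2) | g. labelled_walk ?A ?L (periodic_label x m) 0 ?t g}"
    unfolding alpha_tree_eq_path[OF m l] beta_tree_eq_path[OF m l] using t by (intro brel_path[OF A]; simp)+
  assume k: "(alpha_tree x m l j, beta_tree x m l j) \<in> endo_kernel ?A ?L"
  have "psl_endo (\<lambda>\<gamma> :: 'a birooted. \<gamma>)" unfolding psl_endo_def by auto
  then have eq: "brel ?A ?L (alpha_tree x m l j) = brel ?A ?L (beta_tree x m l j)"
    using k unfolding endo_kernel_def by blast
  have "labelled_walk ?A ?L (periodic_label x m) 1 ?t (\<lambda>p. (p, False))"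
    unfolding labelled_walk_def by (auto simp: fence_adj_iff)
  then have "((1, False), (2, False)) \<in> brel ?A ?L (alpha_tree x m l j)"
    unfolding brel by (intro CollectI exI[of _ "\<lambda>p. (p, False)"]) simp
  then obtain g where g: "labelled_walk ?A ?L (periodic_label x m) 0 ?t g" "g 1 = (1, False)"
    unfolding eq brel by auto
  have "0 < ?t" using t by linarith
  then have "(g 0, g (Suc 0)) \<in> ?A" by (rule labelled_walkD(1)[OF g(1) le0])
  then have e: "(g 0, g 1) \<in> ?A" by simp
  have l0: "periodic_label x m (fst (g 0)) = periodic_label x m 0" using g(1) unfolding labelled_walk_def by auto
  have "fst (g 0) \<noteq> 0" "\<bar>int (fst (g 0)) - int 0\<bar> \<le> 2"
    using fence_adjD(1,5)[OF e] g(2) by auto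
  then show False using periodic_label_neq[OF x m] l0 by blast
qed

section \<open>Substitution when the condition holds\<close>

text \<open>The walk spends the first \<open>2 * n - 2 * m\<close> steps of each period going back and forth between a
  vertex and its thorn.\<close>

lemma folding_walk:
  fixes x :: "nat \<Rightarrow> 'a" and n m k l i j :: nat
  assumes A: "folded_graph A L" and mn: "m \<le> n" and m: "m \<ge> 2" and k: "k \<ge> 1"
    and i: "1 \<le> i" "i \<le> 2 * n" and j: "1 \<le> j" "j \<le> 2 * m"
    and cond: "l > k \<or> (l = k \<and> i \<le> j + (2 * n - 2 * m))"
    and f: "\<And>q. 1 \<le> q \<Longrightarrow> q \<le> 2 * n \<Longrightarrow>
        f (x q) = (if q \<le> 2 * n - 2 * m then x 1 else x (q - (2 * n - 2 * m)))"
    and g: "labelled_walk A L (periodic_label x m) 1 (2 * m * l + j) g"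
  obtains h where "labelled_walk A L (f \<circ> periodic_label x n) 1 (2 * n * k + i) h" "h 1 = g 1"
proof -
  define r where "r = 2 * n - 2 * m"
  \<comment> \<open>As \<open>r\<close> is even, a nonempty waiting phase ends on the thorn, next to
    the vertex at which the walk resumes.\<close>
  have r: "even r" "2 * n = r + 2 * m" using mn by (simp_all add: r_def)
  let ?t = "2 * m * l + j" and ?K = "2 * n * k + i"
  have g1: "(g p, g (Suc p)) \<in> A" if "1 \<le> p" "p < ?t" for p using g that unfolding labelled_walk_def by blast
  have g2: "L (g p) = periodic_label x m p" if "1 \<le> p" "p \<le> ?t" for p
    using g that unfolding labelled_walk_def by blast
  have kl: "k \<le> l" using cond by auto
  have t4: "?t \<ge> 4" using path_length_ge[OF m, of l j] k kl by linarith
  have "\<exists>w. (g p, w) \<in> A \<and> (w, g p) \<in> A \<and> L w = L (g p)" if p: "1 \<le> p" "p \<le> ?t" for p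
  proof -
    have "(g p, g (Suc p)) \<in> A \<or> (g (p - 1), g p) \<in> A"
    proof (cases "p < ?t")
      case False
      then have "(g (p - 1), g (Suc (p - 1))) \<in> A" using p t4 by (intro g1) linarith+
      then show ?thesis using p by simp
    qed (use g1 p in blast)
    then show ?thesis using folded_graph_thorn[OF A] by metis
  qed
  then obtain th where th: "(g p, th p) \<in> A" "(th p, g p) \<in> A" "L (th p) = L (g p)"
    if "1 \<le> p" "p \<le> ?t" for p
    by metis
  \<comment> \<open>The vertex at step \<open>q\<close> of period \<open>a\<close>: first
    \<open>r\<close> steps of waiting at the first vertex of period \<open>a\<close> of
    \<open>g\<close>, then the \<open>2 * m\<close> vertices of that period.\<close>
  define H where "H a q = (if q \<le> r then if odd q then g (2 * m * a + 1) else th (2 * m * a + 1)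
      else g (2 * m * a + (q - r)))" for a q
  define h where "h p = H ((p - 1) div (2 * n)) ((p - 1) mod (2 * n) + 1)" for p
  have hH: "h (2 * n * a + q) = H a q" if "1 \<le> q" "q \<le> 2 * n" for a q
  proof -
    have "2 * n * a + q - 1 = (q - 1) + a * (2 * n)" using that mult.commute[of "2 * n" a] by linarith
    moreover have "((q - 1) + a * (2 * n)) div (2 * n) = a" "((q - 1) + a * (2 * n)) mod (2 * n) = q - 1"
      using that by (simp_all only: div_mult_self1 mod_mult_self1) simp_all
    ultimately show ?thesis using that unfolding h_def by simp
  qed
  have a_le: "a < k \<or> (a = k \<and> q \<le> i)" if "1 \<le> q" "2 * n * a + q \<le> ?K" for a q
  proof (cases a k rule: linorder_cases)
    case greater
    then have "2 * n * Suc k \<le> 2 * n * a" by (intro mult_le_mono2) simp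
    then show ?thesis using that i by simp
  qed (use that in auto)
  have bound: "2 * m * a + 1 \<le> ?t" "r < q \<Longrightarrow> 2 * m * a + (q - r) \<le> ?t"
    if q: "1 \<le> q" "q \<le> 2 * n" "2 * n * a + q \<le> ?K" for a q
  proof -
    have l_mono: "2 * m * b \<le> 2 * m * l" if "b \<le> l" for b using that by (intro mult_le_mono2)
    have "a \<le> k" using a_le[OF q(1,3)] by auto
    then show "2 * m * a + 1 \<le> ?t" using l_mono[of a] kl j by linarith
    assume "r < q"
    show "2 * m * a + (q - r) \<le> ?t"
    \<comment> \<open>A period with \<open>a < l\<close> ends by \<open>2 * m * l\<close>. The
      remaining case is the incomplete last one, with \<open>a = k = l\<close> and
      \<open>q \<le> i\<close>, where \<open>cond\<close> supplies the bound.\<close>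
    proof (cases "Suc a \<le> l")
      case True
      then show ?thesis using l_mono[OF True] q(2) r(2) by simp
    next
      case False
      then have "a = k" "l = k" "q \<le> i" using a_le[OF q(1,3)] kl by auto
      then show ?thesis using cond unfolding r_def[symmetric] by auto
    qed
  qed
  have lab: "L (H a q) = f (periodic_label x n (2 * n * a + q))"
    if q: "1 \<le> q" "q \<le> 2 * n" "2 * n * a + q \<le> ?K" for a q
  proof (cases "q \<le> r")
    case True
    have "L (H a q) = periodic_label x m (2 * m * a + 1)"
      using True bound(1)[OF q] th g2 by (simp add: H_def)
    also have "\<dots> = x 1" using m by (intro periodic_label_add) auto
    finally show ?thesis using True f[OF q(1,2)] by (simp add: r_def periodic_label_add[OF q(1,2)])
  next
    case False
    have "L (H a q) = periodic_label x m (2 * m * a + (q - r))"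
      using False bound(2)[OF q] g2 by (simp add: H_def)
    also have "\<dots> = x (q - r)" using False q r by (intro periodic_label_add) auto
    finally show ?thesis using False f[OF q(1,2)] by (simp add: r_def periodic_label_add[OF q(1,2)])
  qed
  have step: "(H a q, H a (Suc q)) \<in> A" if q: "1 \<le> q" "Suc q \<le> 2 * n" "2 * n * a + Suc q \<le> ?K" for a q
  proof -
    have b1: "1 \<le> 2 * m * a + 1" "2 * m * a + 1 \<le> ?t" using bound(1)[of "Suc q" a] q by auto
    consider "Suc q \<le> r" | "q = r" | "r < q" by linarith
    then show ?thesis
    proof cases
      case 1
      then show ?thesis using th(1,2)[OF b1] by (simp add: H_def)
    next
      case 2
      then show ?thesis using th(2)[OF b1] r(1) q(1) by (simp add: H_def)
    next
      case 3
      have "2 * m * a + (Suc q - r) \<le> ?t" using bound(2)[of "Suc q" a] q 3 by simp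
      then have "(g (2 * m * a + (q - r)), g (Suc (2 * m * a + (q - r)))) \<in> A"
        using 3 by (intro g1) linarith+
      then show ?thesis using 3 by (simp add: H_def Suc_diff_le)
    qed
  qed
  have wrap: "(H a (2 * n), H (Suc a) 1) \<in> A" if "2 * n * Suc a + 1 \<le> ?K" for a
  proof -
    have "H a (2 * n) = g (2 * m * Suc a)" using r m by (simp add: H_def add.commute)
    moreover have "H (Suc a) 1 = g (Suc (2 * m * Suc a))"
      using r(1) by (cases "r = 0") (auto simp: H_def)
    moreover have "2 * m * Suc a + 1 \<le> ?t" using bound(1)[of 1 "Suc a"] that i by simp
    ultimately show ?thesis using g1[of "2 * m * Suc a"] m by simp
  qed
  have decomp: "\<exists>a q. p = 2 * n * a + q \<and> 1 \<le> q \<and> q \<le> 2 * n" if "1 \<le> p" for p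
  proof (intro exI conjI)
    show "p = 2 * n * ((p - 1) div (2 * n)) + ((p - 1) mod (2 * n) + 1)"
      using that mult_div_mod_eq[of "2 * n" "p - 1"] by linarith
    have "(p - 1) mod (2 * n) < 2 * n" using mn m by (intro mod_less_divisor) linarith
    then show "(p - 1) mod (2 * n) + 1 \<le> 2 * n" by linarith
  qed simp
  have "labelled_walk A L (f \<circ> periodic_label x n) 1 ?K h"
    unfolding labelled_walk_def
  proof (intro conjI allI impI)
    fix p assume p: "1 \<le> p" "p < ?K"
    obtain a q where q: "p = 2 * n * a + q" "1 \<le> q" "q \<le> 2 * n" using decomp[OF p(1)] by blast
    show "(h p, h (Suc p)) \<in> A"
    proof (cases "q = 2 * n")
      case True
      have "Suc p = 2 * n * Suc a + 1" using q(1) True by simp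
      then have "h (Suc p) = H (Suc a) 1" using hH[of 1 "Suc a"] i by simp
      moreover have "h p = H a (2 * n)" using hH[OF q(2,3), of a] q(1) True by simp
      ultimately show ?thesis using wrap[of a] p \<open>Suc p = 2 * n * Suc a + 1\<close> by simp
    next
      case False
      then have "h (Suc p) = H a (Suc q)" using hH[of "Suc q" a] q by simp
      moreover have "h p = H a q" using hH[OF q(2,3), of a] q(1) by simp
      ultimately show ?thesis using step[OF q(2), of a] q p False by simp
    qed
  next
    fix p assume p: "1 \<le> p" "p \<le> ?K"
    obtain a q where q: "p = 2 * n * a + q" "1 \<le> q" "q \<le> 2 * n" using decomp[OF p(1)] by blast
    show "L (h p) = (f \<circ> periodic_label x n) p"
      using hH[OF q(2,3), of a] lab[OF q(2,3), of a] q(1) p by simp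
  qed
  moreover have "h 1 = g 1"
    using hH[of 1 0] r(1) i by (cases "r = 0") (auto simp: H_def)
  ultimately show thesis by (rule that)
qed

text \<open>A pair in the relation of the meet comes from a walk \<open>h\<close> of the substituted
  path and a walk \<open>g\<close> of the target path. Their first vertices agree, being equally
  labelled neighbours of \<open>g 2\<close>. Conversely \<open>folding_walk\<close> derives
  \<open>h\<close> from \<open>g\<close>. For \<open>s = 0\<close> the image of the extra leaf is
  exchanged between the two walks.\<close>

lemma meet_substituted_path:
  fixes x :: "nat \<Rightarrow> 'a" and n m k l i j s :: nat
  assumes x: "inj_on x {1..}" and mn: "m \<le> n" and m: "m \<ge> 2" and k: "k \<ge> 1"
    and i: "1 \<le> i" "i \<le> 2 * n" and j: "1 \<le> j" "j \<le> 2 * m"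
    and cond: "l > k \<or> (l = k \<and> i \<le> j + (2 * n - 2 * m))"
    and f: "\<And>q. 1 \<le> q \<Longrightarrow> q \<le> 2 * n \<Longrightarrow>
        f (x q) = (if q \<le> 2 * n - 2 * m then x 1 else x (q - (2 * n - 2 * m)))"
    and s: "s = 0 \<or> s = 1"
  shows "reduced_form (bt_relabel f (abs_birooted (path_graph (periodic_label x n) s (2 * n * k + i)))) \<and>\<^sub>t
      abs_birooted (path_graph (periodic_label x m) 1 (2 * m * l + j)) =
    abs_birooted (path_graph (periodic_label x m) s (2 * m * l + j))" (is "reduced_form ?\<phi> \<and>\<^sub>t ?\<gamma> = ?\<delta>")
proof (rule psl_eqI)
  let ?t = "2 * m * l + j" and ?K = "2 * n * k + i"
  have n: "n \<ge> 2" using m mn by simp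
  have l: "l \<ge> 1" using k cond by auto
  have t: "?t \<ge> 2" "?K \<ge> 2" using path_length_ge[OF m l, of j] path_length_ge[OF n k, of i] by linarith+
  have s1: "s \<le> 1" using s by auto
  show "?\<delta> \<in> free_psl" using periodic_path_in_psl[OF x m s1 t(1)] .
  have f1: "f (periodic_label x n 1) = periodic_label x m 1"
    using f[of 1] n m periodic_label_add[of 1 n x 0] periodic_label_add[of 1 m x 0]
    by (cases "2 * n - 2 * m = 0") auto
  have "\<not> 2 * n \<le> 2 * n - 2 * m" "2 * n - (2 * n - 2 * m) = 2 * m" using n m mn by linarith+
  \<comment> \<open>The last letter goes to the last letter, so the extra leaf keeps its role under
    the substitution.\<close>
  then have f0: "f (periodic_label x n 0) = periodic_label x m 0"
    using f[of "2 * n"] n m by (simp add: periodic_label_0)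
  fix A :: "('a list \<times> 'a list) set" and L :: "'a list \<Rightarrow> 'a"
  assume A: "folded_graph A L"
  have \<phi>: "brel A L (reduced_form ?\<phi>) = {(h 1, h 2) | h. labelled_walk A L (f \<circ> periodic_label x n) s ?K h}"
    unfolding brel_reduced_form[OF A] bt_relabel_abs[OF birooted_tree_path[OF s1 t(2)]] relabel_path
    by (rule brel_path[OF A s1 t(2)])
  have "brel A L (reduced_form ?\<phi> \<and>\<^sub>t ?\<gamma>) = {(u, v) \<in> A.
      (\<exists>h. labelled_walk A L (f \<circ> periodic_label x n) s ?K h \<and> u = h 1) \<and>
      (\<exists>g. labelled_walk A L (periodic_label x m) 1 ?t g \<and> v = g 2)}"
    unfolding brel_meet[OF A] \<phi> brel_path[OF A order.refl t(1)] by auto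
  also have "\<dots> = {(g 1, g 2) | g. labelled_walk A L (periodic_label x m) s ?t g}" (is "?R = ?G")
  proof
    show "?R \<subseteq> ?G"
    proof
      fix e assume "e \<in> ?R"
      then obtain h g where e: "e = (h 1, g 2)" "(h 1, g 2) \<in> A"
        and h: "labelled_walk A L (f \<circ> periodic_label x n) s ?K h"
        and g: "labelled_walk A L (periodic_label x m) 1 ?t g" by blast
      have "L (h 1) = f (periodic_label x n 1)" using h s1 t(2) unfolding labelled_walk_def by simp
      moreover have "L (g 1) = periodic_label x m 1" "(g 1, g 2) \<in> A"
        using g t(1) unfolding labelled_walk_def by (auto simp: numeral_2_eq_2)
      ultimately have eq: "h 1 = g 1"
        using folded_graph_inj[OF A] folded_graph_sym[OF A] e(2) f1 by metis
      have "labelled_walk A L (periodic_label x m) s ?t (g(0 := h 0))"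
        unfolding labelled_walk_def
      proof (intro conjI allI impI)
        fix p assume p: "s \<le> p" "p < ?t"
        show "((g(0 := h 0)) p, (g(0 := h 0)) (Suc p)) \<in> A"
        proof (cases "p = 0")
          case True
          then have "(h 0, h 1) \<in> A" using h p(1) i(1) unfolding labelled_walk_def by simp
          then show ?thesis using True eq by simp
        qed (use g p in \<open>simp add: labelled_walk_def\<close>)
      next
        fix p assume p: "s \<le> p" "p \<le> ?t"
        show "L ((g(0 := h 0)) p) = periodic_label x m p"
        proof (cases "p = 0")
          case True
          then have "L (h 0) = f (periodic_label x n 0)" using h p(1) unfolding labelled_walk_def by simp
          then show ?thesis using True f0 by simp
        qed (use g p in \<open>simp add: labelled_walk_def\<close>)
      qed
      then show "e \<in> ?G" using e(1) eq by (auto intro!: exI[of _ "g(0 := h 0)"])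
    qed
    show "?G \<subseteq> ?R"
    proof
      fix e assume "e \<in> ?G"
      then obtain g where e: "e = (g 1, g 2)" and g: "labelled_walk A L (periodic_label x m) s ?t g" by blast
      then have g1: "labelled_walk A L (periodic_label x m) 1 ?t g" using s1 unfolding labelled_walk_def by simp
      obtain h where h: "labelled_walk A L (f \<circ> periodic_label x n) 1 ?K h" "h 1 = g 1"
        using folding_walk[OF A mn m k i j cond f g1] by blast
      have "labelled_walk A L (f \<circ> periodic_label x n) s ?K (h(0 := g 0))"
        unfolding labelled_walk_def
      proof (intro conjI allI impI)
        fix p assume p: "s \<le> p" "p < ?K"
        show "((h(0 := g 0)) p, (h(0 := g 0)) (Suc p)) \<in> A"
        proof (cases "p = 0")
          case True
          then have "(g 0, g 1) \<in> A" using g p(1) j(1) unfolding labelled_walk_def by simp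
          then show ?thesis using True h(2) by simp
        qed (use h(1) p in \<open>simp add: labelled_walk_def\<close>)
      next
        fix p assume p: "s \<le> p" "p \<le> ?K"
        show "L ((h(0 := g 0)) p) = (f \<circ> periodic_label x n) p"
        proof (cases "p = 0")
          case True
          then have "L (g 0) = periodic_label x m 0" using g p(1) unfolding labelled_walk_def by simp
          then show ?thesis using True f0 by simp
        qed (use h(1) p in \<open>simp add: labelled_walk_def\<close>)
      qed
      then have "\<exists>h. labelled_walk A L (f \<circ> periodic_label x n) s ?K h \<and> g 1 = h 1"
        using h(2) by (intro exI[of _ "h(0 := g 0)"]) simp
      moreover have "(g 1, g 2) \<in> A" using g1 t(1) unfolding labelled_walk_def by (auto simp: numeral_2_eq_2)
      ultimately show "e \<in> ?R" using g1 e by blast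
    qed
  qed
  also have "\<dots> = brel A L ?\<delta>" by (rule brel_path[OF A s1 t(1), symmetric])
  finally show "brel A L (reduced_form ?\<phi> \<and>\<^sub>t ?\<gamma>) = brel A L ?\<delta>" .
qed (rule psl_meet_in_psl)

section \<open>The characterisation of consequence between the pairs\<close>

theorem proposition5p5:
  fixes x :: "nat \<Rightarrow> 'a" and n m k l i j :: nat
  assumes "countable (UNIV :: 'a set)" and "infinite (UNIV :: 'a set)"
    and "inj_on x {1..}"
    and "n \<ge> 2" and "m \<ge> 2"
    and "i \<in> {1..2 * n}" and "j \<in> {1..2 * m}"
    and "k \<ge> 1" and "l \<ge> 1"
  shows "is_consequence (alpha_tree x m l j, beta_tree x m l j) (alpha_tree x n k i, beta_tree x n k i)
    \<longleftrightarrow> (n \<ge> m \<and> l > k) \<or>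
        (n \<ge> m \<and> l = k \<and> int j \<ge> int i + 2 * int m - 2 * int n)"
    (is "?cons \<longleftrightarrow> ?cond")
proof -
  have i: "1 \<le> i" "i \<le> 2 * n" and j: "1 \<le> j" "j \<le> 2 * m" using assms(6,7) by auto
  note x = assms(3) and n = assms(4) and m = assms(5) and k = assms(8) and l = assms(9)
  show ?thesis
  proof
    assume c: ?cons
    show ?cond
    proof (rule ccontr)
      assume fail: "\<not> ?cond"
      let ?\<theta> = "endo_kernel (fence_adj (2 * m * l + j)) (\<lambda>v. periodic_label x m (fst v))"
      have "(alpha_tree x m l j, beta_tree x m l j) \<in> ?\<theta>"
        by (rule is_consequenceD[OF c psl_congruence_endo_kernel[OF folded_fence[OF x m]]
              fully_invariant_endo_kernel alpha_beta_in_endo_kernel[OF x n m k i j(2) fail]])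
      then show False using alpha_beta_not_in_endo_kernel[OF x m l] by blast
    qed
  next
    assume ?cond
    then have mn: "m \<le> n" and cond: "l > k \<or> (l = k \<and> i \<le> j + (2 * n - 2 * m))" by auto
    \<comment> \<open>Among the indices from 1 to \<open>2 * n\<close>, the first
      \<open>2 * n - 2 * m + 1\<close> all become \<open>x 1\<close>, which lets the image of the
      path wait at a vertex and its thorn.\<close>
    define y where "y q = (if q \<le> 2 * n - 2 * m then x 1 else x (q - (2 * n - 2 * m)))" for q
    define f where "f = y \<circ> inv_into {1..} x"
    have f: "f (x q) = (if q \<le> 2 * n - 2 * m then x 1 else x (q - (2 * n - 2 * m)))"
      if "1 \<le> q" "q \<le> 2 * n" for q
      using that inv_into_f_f[OF x, of q] by (simp add: f_def y_def)
    note meet = meet_substituted_path[OF x mn m k i j cond f]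
    show ?cons
      unfolding is_consequence_def fi_congruence_generated_def
    proof (intro InterI, clarify)
      fix \<theta> :: "('a birooted \<times> 'a birooted) set"
      assume \<theta>: "psl_congruence \<theta>" "fully_invariant \<theta>"
        and "{(alpha_tree x n k i, beta_tree x n k i)} \<subseteq> \<theta>"
      then have "(alpha_tree x n k i, beta_tree x n k i) \<in> \<theta>" by simp
      then have 1: "(reduced_form (bt_relabel f (alpha_tree x n k i)),
          reduced_form (bt_relabel f (beta_tree x n k i))) \<in> \<theta>"
        using \<theta>(2) psl_endo_relabel[of f] unfolding fully_invariant_def by blast
      have "alpha_tree x m l j \<in> free_psl"
        unfolding alpha_tree_eq_path[OF m l]
        using path_length_ge[OF m l, of j] by (intro periodic_path_in_psl[OF x m]) auto
      then have 2: "(alpha_tree x m l j, alpha_tree x m l j) \<in> \<theta>"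
        using \<theta>(1) unfolding psl_congruence_def equiv_def refl_on_def by blast
      have "(reduced_form (bt_relabel f (alpha_tree x n k i)) \<and>\<^sub>t alpha_tree x m l j,
          reduced_form (bt_relabel f (beta_tree x n k i)) \<and>\<^sub>t alpha_tree x m l j) \<in> \<theta>"
        using \<theta>(1) 1 2 unfolding psl_congruence_def by blast
      then show "(alpha_tree x m l j, beta_tree x m l j) \<in> \<theta>"
        unfolding alpha_tree_eq_path[OF m l] beta_tree_eq_path[OF m l]
          alpha_tree_eq_path[OF n k] beta_tree_eq_path[OF n k]
        using meet[of 0] meet[of 1] by simp
    qed
  qed
qed

end
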